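(* Let $\chi_1,\chi_2,\dots$ be i.i.d. random variables uniformly distributed on $(0,1)$, let $S_0=0$ and $S_i=\sum_{j=1}^i\chi_j$ for $i\ge1$, and for $t\ge0$ let $N(t)=\min\{i\in\mathbb Z_+:S_i>t\}$ be the counting function of the uniform renewal process. Then, with $\alpha_1\approx-2.0888$ the real part of the root $\alpha_1+\beta_1i=-(2.088843\dots)+(7.461489\dots)i$ of $\lambda-1+e^{-\lambda}=0$, as $t\to\infty$, $$\mathbb E[N(t)^2]=4t^2+\tfrac{10}{3}t+\tfrac23+O(te^{\alpha_1t});\qquad \operatorname{Var}[N(t)]=\tfrac23t+\tfrac29+O(te^{\alpha_1t}).$$
   Context: $\mathbb Z_+=\{0,1,2,\dots\}$. The counting function $N(t)$ counts the renewal at time $0$: $N(t)=1+\max\{i\in\mathbb Z_+:S_i\le t\}$. The nonzero roots of $\lambda-1+e^{-\lambda}=0$ occur in complex conjugate pairs, and $\alpha_1$ is the largest real part among them. *)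

theory Defs
  imports "HOL-Probability.Probability" "HOL-Library.Landau_Symbols"
begin

text \<open>The increments are indexed from 1; the value of \<open>X 0\<close> is never used.\<close>

definition renewal_sum :: "(nat \<Rightarrow> 'a \<Rightarrow> real) \<Rightarrow> nat \<Rightarrow> 'a \<Rightarrow> real" where
  "renewal_sum X i \<omega> = (\<Sum>j=1..i. X j \<omega>)"

text \<open>The minimum exists almost surely; on the exceptional null set the value is unspecified.\<close>

definition renewal_count :: "(nat \<Rightarrow> 'a \<Rightarrow> real) \<Rightarrow> real \<Rightarrow> 'a \<Rightarrow> nat" where
  "renewal_count X t \<omega> = (LEAST i. renewal_sum X i \<omega> > t)"

definition char_root :: "complex \<Rightarrow> bool" where
  "char_root z \<longleftrightarrow> z - 1 + exp (- z) = 0"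

text \<open>\<open>Max\<close> is not applicable here because there are infinitely many roots.\<close>

definition alpha1 :: real where
  "alpha1 = (GREATEST a. \<exists>z. z \<noteq> 0 \<and> char_root z \<and> Re z = a)"

end

theory Submission
  imports Defs "HOL-Real_Asymp.Real_Asymp" "HOL-Complex_Analysis.Complex_Analysis"
begin

text \<open>
  Almost surely \<open>N(t) > n\<close> iff \<open>S\<^sub>n \<le> t\<close>, so \<open>E N = \<Sum>\<^sub>n P(S\<^sub>n \<le> t)\<close> and
  \<open>E N\<^sup>2 = \<Sum>\<^sub>n (2n + 1) P(S\<^sub>n \<le> t)\<close>. Inserting the Irwin--Hall formula for \<open>P(S\<^sub>n \<le> t)\<close> and summing
  over \<open>n\<close> first gives \<open>E N = U(t) = \<Sum>\<^sub>k (-1)\<^sup>k (t-k)\<^sup>k e\<^bsup>t-k\<^esup> / k!\<close> (over \<open>k \<le> t\<close>) and, with the same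
  computation, \<open>E N\<^sup>2 = (2t + 1) U(t)\<close>. Hence everything follows from \<open>U(t) = 2t + 2/3 + O(e\<^bsup>alpha1 t\<^esup>)\<close>.

  For fixed \<open>s\<close> in \<open>[0, 1)\<close> one has \<open>\<Sum>\<^sub>n U(n + s) z\<^sup>n = e\<^bsup>s(1-z)\<^esup> / (1 - z e\<^bsup>1-z\<^esup>)\<close>, which is meromorphic in the
  whole plane. Its poles are the points \<open>z = 1 - \<lambda>\<close> with \<open>\<lambda>\<close> a characteristic root, and there
  \<open>\<bar>z\<bar> = e\<^bsup>-Re \<lambda>\<^esup>\<close>. In \<open>\<bar>z\<bar> < 12\<close> these are the double pole \<open>1\<close>, responsible for \<open>2t + 2/3\<close>, and two
  conjugate simple poles of modulus \<open>e\<^bsup>-alpha1\<^esup>\<close>, responsible for the error term; once the principal parts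
  are removed, Cauchy's inequality on \<open>\<bar>z\<bar> = 10\<close> bounds the remaining coefficients uniformly in \<open>s\<close>.
\<close>

section \<open>Numerical bounds\<close>

text \<open>Doubling the angle multiplies the error by at most four: the two factors of the product
  contribute \<open>e\<close> each, the double-angle formula doubles this, and \<open>r\<close>
  absorbs the rounding of the new value to a decimal.\<close>

lemma sin_double_approx:
  fixes x :: real
  assumes "\<bar>sin x - s\<bar> \<le> e" "\<bar>cos x - c\<bar> \<le> e" "\<bar>s\<bar> \<le> 1" "\<bar>2 * s * c - s'\<bar> \<le> r"
  shows "\<bar>sin (2 * x) - s'\<bar> \<le> 4 * e + r"
proof -
  have "\<bar>sin x * cos x - s * c\<bar> = \<bar>(sin x - s) * cos x + s * (cos x - c)\<bar>"
    by (simp add: algebra_simps)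
  also have "\<dots> \<le> \<bar>sin x - s\<bar> * \<bar>cos x\<bar> + \<bar>s\<bar> * \<bar>cos x - c\<bar>"
    by (metis abs_mult abs_triangle_ineq)
  also have "\<dots> \<le> e * 1 + 1 * e"
    using assms by (intro add_mono mult_mono) auto
  finally show ?thesis
    using assms(4) unfolding sin_double by linarith
qed

lemma cos_double_approx:
  fixes x :: real
  assumes "\<bar>sin x - s\<bar> \<le> e" "\<bar>cos x - c\<bar> \<le> e" "\<bar>s\<bar> \<le> 1" "\<bar>1 - 2 * s\<^sup>2 - c'\<bar> \<le> r"
  shows "\<bar>cos (2 * x) - c'\<bar> \<le> 4 * e + r"
proof -
  have "\<bar>(sin x)\<^sup>2 - s\<^sup>2\<bar> = \<bar>sin x - s\<bar> * \<bar>sin x + s\<bar>"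
    by (simp add: power2_eq_square algebra_simps flip: abs_mult)
  also have "\<dots> \<le> e * 2"
    using assms(1,3) abs_sin_le_one[of x] by (intro mult_mono) linarith+
  finally show ?thesis
    using assms(4) unfolding cos_double_sin by linarith
qed

lemma approx_trans:
  fixes a b c :: real
  assumes "\<bar>a - b\<bar> \<le> e" "\<bar>b - c\<bar> \<le> d" "e + d \<le> r"
  shows "\<bar>a - c\<bar> \<le> r"
  using assms by linarith

text \<open>Taylor polynomials of degree 15 and 14, with remainder at most
  \<open>x ^ 16 / fact 16\<close>. The Horner form lets them be evaluated directly at a decimal
  argument.\<close>

lemma sin_cos_horner_approx:
  fixes x :: real
  assumes "0 \<le> x" "x \<le> 19/20"
  shows "\<bar>sin x - x * (1 - x^2 / 6 * (1 - x^2 / 20 * (1 - x^2 / 42 * (1 - x^2 / 72 * (1 - x^2 / 110 * (1 - x^2 / 156 * (1 - x^2 / 210 * 1)))))))\<bar> \<le> 1 / 10 ^ 13 / 4"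
    "\<bar>cos x - (1 - x^2 / 2 * (1 - x^2 / 12 * (1 - x^2 / 30 * (1 - x^2 / 56 * (1 - x^2 / 90 * (1 - x^2 / 132 * (1 - x^2 / 182 * 1)))))))\<bar> \<le> 1 / 10 ^ 13 / 4"
proof -
  have "x ^ 16 \<le> (19/20) ^ 16"
    using assms by (intro power_mono) auto
  then have r: "x ^ 16 / fact 16 \<le> 1 / 10 ^ 13 / 4"
    by (simp add: fact_numeral field_simps)
  have "\<bar>sin x - (\<Sum>m<16. sin_coeff m * x ^ m)\<bar> \<le> 1 / 10 ^ 13 / 4"
    using Maclaurin_sin_bound[of x 16] assms(1) r by (simp only: divide_inverse mult.commute abs_of_nonneg)
  also have "(\<Sum>m<16. sin_coeff m * x ^ m) = x * (1 - x^2 / 6 * (1 - x^2 / 20 * (1 - x^2 / 42 * (1 - x^2 / 72 * (1 - x^2 / 110 * (1 - x^2 / 156 * (1 - x^2 / 210 * 1)))))))"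
    by (simp add: sin_coeff_def lessThan_nat_numeral fact_numeral)
       (simp add: right_diff_distrib distrib_left diff_divide_distrib add_divide_distrib mult.assoc flip: power_add power_Suc)
  finally show "\<bar>sin x - x * (1 - x^2 / 6 * (1 - x^2 / 20 * (1 - x^2 / 42 * (1 - x^2 / 72 * (1 - x^2 / 110 * (1 - x^2 / 156 * (1 - x^2 / 210 * 1)))))))\<bar> \<le> 1 / 10 ^ 13 / 4" .
  obtain t where "cos x = (\<Sum>m<16. cos_coeff m * x ^ m) + cos (t + 1 / 2 * real 16 * pi) / fact 16 * x ^ 16"
    using Maclaurin_cos_expansion[of x 16] by blast
  then have "\<bar>cos x - (\<Sum>m<16. cos_coeff m * x ^ m)\<bar> = \<bar>cos (t + 1 / 2 * real 16 * pi)\<bar> * (x ^ 16 / fact 16)"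
    using assms by (simp add: abs_mult)
  also have "\<dots> \<le> 1 * (x ^ 16 / fact 16)"
    using assms by (intro mult_right_mono) auto
  also have "\<dots> \<le> 1 / 10 ^ 13 / 4"
    using r by simp
  also have "(\<Sum>m<16. cos_coeff m * x ^ m) = (1 - x^2 / 2 * (1 - x^2 / 12 * (1 - x^2 / 30 * (1 - x^2 / 56 * (1 - x^2 / 90 * (1 - x^2 / 132 * (1 - x^2 / 182 * 1)))))))"
    by (simp add: cos_coeff_def lessThan_nat_numeral fact_numeral)
       (simp add: right_diff_distrib distrib_left diff_divide_distrib add_divide_distrib mult.assoc flip: power_add power_Suc)
  finally show "\<bar>cos x - (1 - x^2 / 2 * (1 - x^2 / 12 * (1 - x^2 / 30 * (1 - x^2 / 56 * (1 - x^2 / 90 * (1 - x^2 / 132 * (1 - x^2 / 182 * 1)))))))\<bar> \<le> 1 / 10 ^ 13 / 4" .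
qed

text \<open>
  \<open>7.46148928\<close> and \<open>7.46148929\<close> bracket the imaginary part of the dominant root. The bracket has to be this
  narrow because \<open>- alpha1\<close> exceeds \<open>2.088843\<close> by less than \<open>1.6 * 10\<^sup>-\<^sup>8\<close>.
\<close>

lemma sin_cos_lower_bracket:
  "\<bar>sin 7.46148928 - 0.9239586240442\<bar> \<le> (1 / 10 ^ 10 :: real)"
  "\<bar>cos 7.46148928 - 0.3824924326760\<bar> \<le> (1 / 10 ^ 10 :: real)"
proof -
  \<comment> \<open>One eighth of \<open>7.46148928\<close>, small enough for the Taylor bound.
    Three doublings, each with a fresh rounding of at most \<open>1 / 10 ^ 12\<close>, lead back and
    leave an error below \<open>1 / 10 ^ 10\<close>.\<close>
  let ?x = "0.93268616 :: real"
  have hs: "\<bar>?x * (1 - ?x^2 / 6 * (1 - ?x^2 / 20 * (1 - ?x^2 / 42 * (1 - ?x^2 / 72 * (1 - ?x^2 / 110 * (1 - ?x^2 / 156 * (1 - ?x^2 / 210 * 1))))))) - 0.8032229246577\<bar> \<le> 3 / 4 / 10 ^ 13"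
    by (simp add: power_divide)
  have s: "\<bar>sin ?x - 0.8032229246577\<bar> \<le> 1 / 10 ^ 13"
    by (rule approx_trans[OF sin_cos_horner_approx(1)[of ?x] hs]) simp_all
  have hc: "\<bar>(1 - ?x^2 / 2 * (1 - ?x^2 / 12 * (1 - ?x^2 / 30 * (1 - ?x^2 / 56 * (1 - ?x^2 / 90 * (1 - ?x^2 / 132 * (1 - ?x^2 / 182 * 1))))))) - 0.5956785486354\<bar> \<le> 3 / 4 / 10 ^ 13"
    by (simp add: power_divide)
  have c: "\<bar>cos ?x - 0.5956785486354\<bar> \<le> 1 / 10 ^ 13"
    by (rule approx_trans[OF sin_cos_horner_approx(2)[of ?x] hc]) simp_all
  have 1: "\<bar>sin (2 * ?x) - 0.9569253319815\<bar> \<le> 4 * (1 / 10 ^ 13) + 1 / 10 ^ 12"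
    "\<bar>cos (2 * ?x) - (- 0.2903341333912)\<bar> \<le> 4 * (1 / 10 ^ 13) + 1 / 10 ^ 12"
    by (rule sin_double_approx[OF s c] cos_double_approx[OF s c]; simp add: power_divide)+
  have 2: "\<bar>sin (2 * (2 * ?x)) - (- 0.5556561739619)\<bar> \<le> 4 * (4 * (1 / 10 ^ 13) + 1 / 10 ^ 12) + 1 / 10 ^ 12"
    "\<bar>cos (2 * (2 * ?x)) - (- 0.8314121819759)\<bar> \<le> 4 * (4 * (1 / 10 ^ 13) + 1 / 10 ^ 12) + 1 / 10 ^ 12"
    by (rule sin_double_approx[OF 1] cos_double_approx[OF 1]; simp add: power_divide)+
  have 3: "\<bar>sin (2 * (2 * (2 * ?x))) - 0.9239586240442\<bar> \<le> 4 * (4 * (4 * (1 / 10 ^ 13) + 1 / 10 ^ 12) + 1 / 10 ^ 12) + 1 / 10 ^ 12"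
    "\<bar>cos (2 * (2 * (2 * ?x))) - 0.3824924326760\<bar> \<le> 4 * (4 * (4 * (1 / 10 ^ 13) + 1 / 10 ^ 12) + 1 / 10 ^ 12) + 1 / 10 ^ 12"
    by (rule sin_double_approx[OF 2] cos_double_approx[OF 2]; simp add: power_divide)+
  have "2 * (2 * (2 * ?x)) = 7.46148928"
    by simp
  note 4 = 3[unfolded this]
  show "\<bar>sin 7.46148928 - 0.9239586240442\<bar> \<le> (1 / 10 ^ 10 :: real)"
    using 4(1) by simp
  show "\<bar>cos 7.46148928 - 0.3824924326760\<bar> \<le> (1 / 10 ^ 10 :: real)"
    using 4(2) by simp
qed

lemma sin_cos_upper_bracket:
  "\<bar>sin 7.46148929 - 0.9239586278691\<bar> \<le> (1 / 10 ^ 10 :: real)"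
  "\<bar>cos 7.46148929 - 0.3824924234364\<bar> \<le> (1 / 10 ^ 10 :: real)"
proof -
  let ?x = "0.93268616125 :: real"
  have hs: "\<bar>?x * (1 - ?x^2 / 6 * (1 - ?x^2 / 20 * (1 - ?x^2 / 42 * (1 - ?x^2 / 72 * (1 - ?x^2 / 110 * (1 - ?x^2 / 156 * (1 - ?x^2 / 210 * 1))))))) - 0.8032229254023\<bar> \<le> 3 / 4 / 10 ^ 13"
    by (simp add: power_divide)
  have s: "\<bar>sin ?x - 0.8032229254023\<bar> \<le> 1 / 10 ^ 13"
    by (rule approx_trans[OF sin_cos_horner_approx(1)[of ?x] hs]) simp_all
  have hc: "\<bar>(1 - ?x^2 / 2 * (1 - ?x^2 / 12 * (1 - ?x^2 / 30 * (1 - ?x^2 / 56 * (1 - ?x^2 / 90 * (1 - ?x^2 / 132 * (1 - ?x^2 / 182 * 1))))))) - 0.5956785476314\<bar> \<le> 3 / 4 / 10 ^ 13"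
    by (simp add: power_divide)
  have c: "\<bar>cos ?x - 0.5956785476314\<bar> \<le> 1 / 10 ^ 13"
    by (rule approx_trans[OF sin_cos_horner_approx(2)[of ?x] hc]) simp_all
  have 1: "\<bar>sin (2 * ?x) - 0.9569253312557\<bar> \<le> 4 * (1 / 10 ^ 13) + 1 / 10 ^ 12"
    "\<bar>cos (2 * ?x) - (- 0.2903341357835)\<bar> \<le> 4 * (1 / 10 ^ 13) + 1 / 10 ^ 12"
    by (rule sin_double_approx[OF s c] cos_double_approx[OF s c]; simp add: power_divide)+
  have 2: "\<bar>sin (2 * (2 * ?x)) - (- 0.5556561781190)\<bar> \<le> 4 * (4 * (1 / 10 ^ 13) + 1 / 10 ^ 12) + 1 / 10 ^ 12"
    "\<bar>cos (2 * (2 * ?x)) - (- 0.8314121791977)\<bar> \<le> 4 * (4 * (1 / 10 ^ 13) + 1 / 10 ^ 12) + 1 / 10 ^ 12"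
    by (rule sin_double_approx[OF 1] cos_double_approx[OF 1]; simp add: power_divide)+
  have 3: "\<bar>sin (2 * (2 * (2 * ?x))) - 0.9239586278691\<bar> \<le> 4 * (4 * (4 * (1 / 10 ^ 13) + 1 / 10 ^ 12) + 1 / 10 ^ 12) + 1 / 10 ^ 12"
    "\<bar>cos (2 * (2 * (2 * ?x))) - 0.3824924234364\<bar> \<le> 4 * (4 * (4 * (1 / 10 ^ 13) + 1 / 10 ^ 12) + 1 / 10 ^ 12) + 1 / 10 ^ 12"
    by (rule sin_double_approx[OF 2] cos_double_approx[OF 2]; simp add: power_divide)+
  have "2 * (2 * (2 * ?x)) = 7.46148929"
    by simp
  note 4 = 3[unfolded this]
  show "\<bar>sin 7.46148929 - 0.9239586278691\<bar> \<le> (1 / 10 ^ 10 :: real)"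
    using 4(1) by simp
  show "\<bar>cos 7.46148929 - 0.3824924234364\<bar> \<le> (1 / 10 ^ 10 :: real)"
    using 4(2) by simp
qed

lemma exp_2088843_bounds: "8.075566326 \<le> exp (2.088843 :: real)" "exp (2.088843 :: real) \<le> 8.075566329"
proof -
  \<comment> \<open>One eighth of \<open>2.088843\<close>; a Taylor polynomial of degree 10 is
    accurate enough here, and the eighth power recovers the value.\<close>
  let ?y = "0.261105375 :: real"
  have "exp ?y \<le> 2"
    using exp_bound_half[of ?y] by simp
  obtain t where t: "\<bar>t\<bar> \<le> \<bar>?y\<bar>" "exp ?y = (\<Sum>m<11. ?y ^ m / fact m) + exp t / fact 11 * ?y ^ 11"
    using Maclaurin_exp_le[of ?y 11] by blast
  have "exp t \<le> exp ?y"
    using t(1) by simp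
  with \<open>exp ?y \<le> 2\<close> have "exp t \<le> 2"
    by linarith
  then have e: "0 \<le> exp t / fact 11 * ?y ^ 11" "exp t / fact 11 * ?y ^ 11 \<le> 2 / fact 11 * (3/10) ^ 11"
    by (simp, intro mult_mono divide_right_mono power_mono) auto
  have "(\<Sum>m<11. y ^ m / fact m) = (1 + y / 1 * (1 + y / 2 * (1 + y / 3 * (1 + y / 4 * (1 + y / 5 * (1 + y / 6 * (1 + y / 7 * (1 + y / 8 * (1 + y / 9 * (1 + y / 10 * 1))))))))))" for y :: real
    by (simp add: lessThan_nat_numeral fact_numeral)
       (simp add: distrib_left add_divide_distrib mult.assoc power_numeral_reduce)
  note h = t(2)[unfolded this]
  have "1.29836447337 \<le> (1 + ?y / 1 * (1 + ?y / 2 * (1 + ?y / 3 * (1 + ?y / 4 * (1 + ?y / 5 * (1 + ?y / 6 * (1 + ?y / 7 * (1 + ?y / 8 * (1 + ?y / 9 * (1 + ?y / 10 * 1))))))))))" "(1 + ?y / 1 * (1 + ?y / 2 * (1 + ?y / 3 * (1 + ?y / 4 * (1 + ?y / 5 * (1 + ?y / 6 * (1 + ?y / 7 * (1 + ?y / 8 * (1 + ?y / 9 * (1 + ?y / 10 * 1)))))))))) \<le> 1.29836447339"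
    by simp_all
  then have b: "1.29836447337 \<le> exp ?y" "exp ?y \<le> 1.29836447339 + 2 / fact 11 * (3/10) ^ 11"
    unfolding h using e by (simp_all only: add_increasing2 add_mono)
  have "1.29836447339 + 2 / fact 11 * (3/10) ^ 11 \<le> (1.2983644734 :: real)"
    by (simp add: fact_numeral power_divide)
  with b(2) have b2: "exp ?y \<le> 1.2983644734"
    by (rule order_trans)
  have p: "exp 2.088843 = exp ?y ^ 8"
    by (simp flip: exp_of_nat_mult)
  have n: "8.075566326 \<le> (1.29836447337 :: real) ^ 8" "(1.2983644734 :: real) ^ 8 \<le> 8.075566329"
    by (simp_all add: power_divide)
  show "8.075566326 \<le> exp (2.088843 :: real)"
    unfolding p by (rule order_trans[OF n(1) power_mono[OF b(1)]]) simp
  show "exp (2.088843 :: real) \<le> 8.075566329"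
    unfolding p by (rule order_trans[OF power_mono[OF b2] n(2)]) simp
qed

text \<open>Ensures that the two conjugate poles, of modulus \<open>exp (- alpha1)\<close>, lie
  inside the circle of radius 10 used for Cauchy's inequality.\<close>

lemma exp_2088844_less: "exp (2.088844 :: real) < 10"
proof -
  have "exp (2.088844 :: real) = exp 2.088843 * exp 0.000001"
    by (simp flip: exp_add)
  also have "\<dots> \<le> 9 * 1.1"
    using exp_2088843_bounds(2) exp_bound[of "0.000001"] by (intro mult_mono) (auto simp: power_divide)
  finally show ?thesis
    by simp
qed

section \<open>The dominant characteristic root\<close>

text \<open>
  A root \<open>a + b i\<close> with \<open>b > 0\<close> satisfies \<open>e\<^sup>-\<^sup>a = b / sin b\<close>; eliminating \<open>a\<close> leaves one real equation
  for \<open>b\<close>, whose left-hand side decreases on every interval where \<open>sin\<close> is positive.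
\<close>

definition root_fun :: "real \<Rightarrow> real" where
  "root_fun b = ln (sin b / b) - 1 + b * cos b / sin b"

lemma char_root_Complex_iff:
  "char_root (Complex a b) \<longleftrightarrow> a - 1 + exp (- a) * cos b = 0 \<and> b = exp (- a) * sin b"
  by (simp add: char_root_def complex_eq_iff Re_exp Im_exp)

lemma char_root_imp_root_fun:
  assumes "char_root (Complex a b)" "b > 0"
  shows "sin b > 0" "exp (- a) = b / sin b" "a = ln (sin b / b)" "root_fun b = 0"
proof -
  have eq: "a - 1 + exp (- a) * cos b = 0" "b = exp (- a) * sin b"
    using assms(1) by (auto simp: char_root_Complex_iff)
  show s: "sin b > 0"
    using eq(2) assms(2) by (metis exp_gt_zero zero_less_mult_pos)
  show e: "exp (- a) = b / sin b"
    using eq(2) s by (simp add: field_simps)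
  have "exp a = sin b / b"
    using arg_cong[OF e, of inverse] by (simp add: exp_minus)
  then show a: "a = ln (sin b / b)"
    by (metis ln_exp)
  show "root_fun b = 0"
    using eq(1) unfolding e root_fun_def a[symmetric] by simp
qed

lemma root_fun_imp_char_root:
  assumes "b > 0" "sin b > 0" "root_fun b = 0"
  shows "char_root (Complex (ln (sin b / b)) b)"
proof -
  have "exp (- ln (sin b / b)) = b / sin b"
    using assms(1,2) by (simp add: exp_minus)
  then show ?thesis
    using assms unfolding char_root_Complex_iff by (simp add: root_fun_def)
qed

text \<open>By sin^2 + cos^2 = 1 the numerator becomes minus a sum of two even powers, which makes
  the negative sign visible.\<close>

lemma root_fun_has_derivative:
  assumes "b > 0" "sin b > 0"
  shows "(root_fun has_real_derivative - ((b - sin b * cos b)\<^sup>2 + (sin b) ^ 4) / (b * (sin b)\<^sup>2)) (at b)"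
proof -
  have "(root_fun has_real_derivative
          (cos b * b - sin b) / (b * b) / (sin b / b)
          + ((cos b - b * sin b) * sin b - b * cos b * cos b) / (sin b * sin b)) (at b)"
    unfolding root_fun_def using assms
    by (auto intro!: derivative_eq_intros simp: field_simps)
  moreover have "(cos b * b - sin b) / (b * b) / (sin b / b)
          + ((cos b - b * sin b) * sin b - b * cos b * cos b) / (sin b * sin b)
          = - ((b - sin b * cos b)\<^sup>2 + (sin b) ^ 4) / (b * (sin b)\<^sup>2)"
  proof -
    have "(cos b * b - sin b) * sin b + b * ((cos b - b * sin b) * sin b - b * cos b * cos b)
        = - ((b - sin b * cos b)\<^sup>2 + (sin b) ^ 4)"
      using sin_cos_squared_add[of b] by algebra
    then show ?thesis
      using assms by (simp add: divide_simps) (simp add: power2_eq_square algebra_simps)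
  qed
  ultimately show ?thesis
    by simp
qed

lemma root_fun_decreasing:
  assumes "0 < b" "b < c" "\<And>x. b \<le> x \<Longrightarrow> x \<le> c \<Longrightarrow> sin x > 0"
  shows "root_fun c < root_fun b"
proof (rule DERIV_neg_imp_decreasing[OF assms(2)])
  fix x assume x: "b \<le> x" "x \<le> c"
  with assms have "x > 0" "sin x > 0"
    by auto
  moreover from this have "- ((x - sin x * cos x)\<^sup>2 + (sin x) ^ 4) / (x * (sin x)\<^sup>2) < 0"
    by (intro divide_neg_pos mult_pos_pos iffD2[OF neg_less_0_iff_less] add_nonneg_pos) auto
  ultimately show "\<exists>y. (root_fun has_real_derivative y) (at x) \<and> y < 0"
    using root_fun_has_derivative by blast
qed

text \<open>\<open>root_fun\<close> tends to 0 at the origin and decreases strictly, so no root has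
  its imaginary part in (0, pi). The limit gives only a weak inequality, at \<open>b / 2\<close>;
  the decrease from there to \<open>b\<close> makes it strict.\<close>

lemma root_fun_neg:
  assumes "0 < b" "b < pi"
  shows "root_fun b < 0"
proof -
  have lim: "(root_fun \<longlongrightarrow> 0) (at_right 0)"
    unfolding root_fun_def by real_asymp
  have dec: "root_fun c < root_fun a" if "0 < a" "a < c" "c < pi" for a c
    using that by (intro root_fun_decreasing sin_gt_zero) auto
  have "eventually (\<lambda>x. root_fun (b / 2) \<le> root_fun x) (at_right 0)"
    using eventually_at_right_real[of 0 "b / 2"]
    by (rule eventually_mono) (use assms in \<open>auto intro!: less_imp_le dec\<close>)
  then have "root_fun (b / 2) \<le> 0"
    by (rule tendsto_lowerbound[OF lim]) simp
  with dec[of "b / 2" b] assms show ?thesis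
    by simp
qed

lemma char_root_cnj: "char_root z \<Longrightarrow> char_root (cnj z)"
proof -
  assume "char_root z"
  then have "cnj (z - 1 + exp (- z)) = 0"
    by (simp add: char_root_def)
  then show ?thesis
    by (simp add: char_root_def exp_cnj)
qed

lemma root_fun_bracket:
  shows "2 * pi < 7.46148928"
    and "root_fun 7.46148928 > 0" and "root_fun 7.46148929 < 0"
    and "2 * pi < b \<Longrightarrow> b < 3 * pi \<Longrightarrow> sin b > 0"
proof -
  let ?b = "7.46148928 :: real" and ?c = "7.46148929 :: real"
  have s: "0.92395862394 \<le> sin ?b" "sin ?b \<le> 0.92395862415"
    using sin_cos_lower_bracket(1)[unfolded abs_le_iff] by simp_all
  have c: "0.38249243257 \<le> cos ?b"
    using sin_cos_lower_bracket(2)[unfolded abs_le_iff] by simp_all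
  have s': "0.92395862776 \<le> sin ?c" "sin ?c \<le> 0.92395862797"
    using sin_cos_upper_bracket(1)[unfolded abs_le_iff] by simp_all
  have c': "cos ?c \<le> 0.38249242354"
    using sin_cos_upper_bracket(2)[unfolded abs_le_iff] by simp_all
  \<comment> \<open>Otherwise \<open>?b\<close> would lie in (pi, 2 pi], where the sine is not
    positive, against the decimal value of \<open>sin ?b\<close>.\<close>
  show "2 * pi < ?b"
  proof (rule ccontr)
    assume "\<not> ?thesis"
    then consider "?b = 2 * pi" | "pi < ?b" "?b < 2 * pi"
      using pi_less_4 by fastforce
    then have "sin ?b \<le> 0"
    proof cases
      case 1
      then show ?thesis
        by (simp only: sin_two_pi order_refl)
    next
      case 2
      then show ?thesis
        using sin_lt_zero[of ?b] by simp
    qed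
    with s(1) show False
      by simp
  qed
  \<comment> \<open>The sign is settled by two decimals that differ by 1: the logarithm is at least
    \<open>- 2.08884305\<close> and the quotient exceeds \<open>3.08884305\<close>. At the right
    endpoint \<open>2.088843\<close> and \<open>3.088843\<close> serve in the same way with the
    inequalities reversed.\<close>
  have e: "8.0755667 \<le> exp (2.08884305 :: real)"
  proof -
    have "8.0755667 \<le> (8.075566326 :: real) * (1 + 0.00000005)"
      by simp
    also have "\<dots> \<le> exp 2.088843 * exp 0.00000005"
      by (intro mult_mono exp_2088843_bounds exp_ge_add_one_self) auto
    also have "\<dots> = exp 2.08884305"
      by (simp flip: exp_add)
    finally show ?thesis .
  qed
  have "- ln (sin ?b / ?b) = ln (?b / sin ?b)"
    using s(1) by (subst ln_inverse[symmetric]) auto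
  also have "\<dots> \<le> ln (exp 2.08884305)"
  proof (subst ln_le_cancel_iff)
    have "?b / sin ?b \<le> ?b / 0.92395862394"
      using s(1) by (intro divide_left_mono) auto
    also have "\<dots> \<le> 8.0755667"
      by simp
    finally show "?b / sin ?b \<le> exp 2.08884305"
      using e by linarith
  qed (use s in auto)
  finally have l: "ln (sin ?b / ?b) \<ge> - 2.08884305"
    by simp
  have "3.08884305 < ?b * 0.38249243257 / 0.92395862415"
    by simp
  also have "\<dots> \<le> ?b * cos ?b / sin ?b"
    using s c by (intro frac_le mult_left_mono) auto
  finally have m: "3.08884305 < ?b * cos ?b / sin ?b" .
  have "0 < x - 1 + y" if "- 2.08884305 \<le> x" "3.08884305 < y" for x y :: real
    using that by simp
  from this[OF l m] show "root_fun ?b > 0"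
    unfolding root_fun_def .
  have "ln (sin ?c / ?c) = - ln (?c / sin ?c)"
    using s'(1) by (subst ln_inverse[symmetric]) auto
  also have "\<dots> \<le> - ln (exp 2.088843)"
  proof -
    have "exp 2.088843 \<le> ?c / 0.92395862797"
      using exp_2088843_bounds(2) by (rule order_trans) simp
    also have "\<dots> \<le> ?c / sin ?c"
      using s' by (intro divide_left_mono) auto
    finally have "ln (exp 2.088843) \<le> ln (?c / sin ?c)"
      using s'(1) by (subst ln_le_cancel_iff) auto
    then show ?thesis
      by (simp only: neg_le_iff_le)
  qed
  finally have l': "ln (sin ?c / ?c) \<le> - 2.088843"
    by simp
  have "?c * cos ?c / sin ?c \<le> ?c * 0.38249242354 / 0.92395862776"
    using s' c' by (intro frac_le mult_left_mono) auto
  also have "\<dots> < 3.088843"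
    by simp
  finally have m': "?c * cos ?c / sin ?c < 3.088843" .
  have "x - 1 + y < 0" if "x \<le> - 2.088843" "y < 3.088843" for x y :: real
    using that by simp
  from this[OF l' m'] show "root_fun ?c < 0"
    unfolding root_fun_def .
  show "sin b > 0" if "2 * pi < b" "b < 3 * pi"
    using sin_gt_zero[of "b - 2 * pi"] that by (simp add: sin_diff)
qed

text \<open>Excludes nonzero real characteristic roots. Squaring 1 + x/2 \<le> exp (x/2), whose left
  side is positive as x > -1, leaves x^2/4 \<le> 0.\<close>

lemma exp_eq_one_plus_self_iff: "exp x = 1 + x \<longleftrightarrow> x = 0" for x :: real
proof
  assume eq: "exp x = 1 + x"
  then have "x > - 1"
    using exp_gt_zero[of x] by linarith
  then have "(1 + x / 2)\<^sup>2 \<le> (exp (x / 2))\<^sup>2"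
    by (intro power_mono exp_ge_add_one_self) auto
  also have "\<dots> = 1 + x"
    by (simp add: eq flip: exp_double)
  finally have "x\<^sup>2 \<le> 0"
    by (simp add: power2_eq_square field_simps)
  then show "x = 0"
    by simp
qed simp

text \<open>The intermediate value theorem yields a root in the bracket. Uniqueness holds because
  the bound 12 < 4 pi confines a positive imaginary part to (0, pi) or (2 pi, 3 pi):
  \<open>root_fun\<close> has no zero on the first interval and is strictly decreasing on the
  second.\<close>

lemma ex_dominant_root:
  obtains a b where "char_root (Complex a b)" "2.088843 \<le> - a" "- a < 2.088844"
    "7.461489 \<le> b" "b < 7.461490"
    "\<And>z. char_root z \<Longrightarrow> z \<noteq> 0 \<Longrightarrow> exp (- Re z) < 12 \<Longrightarrow> z = Complex a b \<or> z = Complex a (- b)"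
proof -
  note pos = root_fun_bracket(4)
  have "\<exists>x\<ge>7.46148928. x \<le> 7.46148929 \<and> root_fun x = 0"
  proof (rule IVT2')
    show "continuous_on {7.46148928..7.46148929} root_fun"
    proof (intro continuous_at_imp_continuous_on ballI)
      fix x :: real assume "x \<in> {7.46148928..7.46148929}"
      then show "isCont root_fun x"
        using pos[of x] root_fun_bracket(1) pi_gt3
        by (intro DERIV_isCont[OF root_fun_has_derivative]) auto
    qed
  qed (use root_fun_bracket in auto)
  then obtain b where b: "7.46148928 \<le> b" "b \<le> 7.46148929" "root_fun b = 0"
    by auto
  have b2: "2 * pi < b" "b < 3 * pi" "b > 0"
    using b root_fun_bracket(1) pi_gt3 by auto
  then have sb: "sin b > 0"
    using pos by blast
  define a where "a = ln (sin b / b)"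
  have root: "char_root (Complex a b)"
    unfolding a_def by (rule root_fun_imp_char_root) fact+
  note fromroot = char_root_imp_root_fun[OF root \<open>b > 0\<close>]
  \<comment> \<open>The sine is 1-Lipschitz, so its known value at the endpoint carries over to the
    unknown \<open>b\<close> at a cost of \<open>10 ^ -8\<close>.\<close>
  have "\<bar>sin b - sin 7.46148928\<bar> \<le> \<bar>b - 7.46148928\<bar>"
  proof -
    have "\<bar>sin b - sin 7.46148928\<bar> = 2 * \<bar>sin ((b - 7.46148928) / 2)\<bar> * \<bar>cos ((b + 7.46148928) / 2)\<bar>"
      by (simp add: sin_diff_sin abs_mult)
    also have "\<dots> \<le> 2 * \<bar>(b - 7.46148928) / 2\<bar> * 1"
      by (intro mult_mono abs_sin_x_le_abs_x) auto
    finally show ?thesis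
      by simp
  qed
  then have s: "0.92395861394 \<le> sin b" "sin b \<le> 0.92395863415"
    using sin_cos_lower_bracket(1)[unfolded abs_le_iff] b by (simp_all add: abs_le_iff)
  have "exp 2.088843 \<le> 7.46148928 / (0.92395863415 :: real)"
    using exp_2088843_bounds(2) by (rule order_trans) simp
  also have "\<dots> \<le> b / sin b"
    using s b by (intro frac_le) auto
  finally have "exp 2.088843 \<le> exp (- a)"
    by (simp only: fromroot(2))
  then have a1: "2.088843 \<le> - a"
    by simp
  have "b / sin b \<le> 7.46148929 / 0.92395861394"
    using s b by (intro frac_le) auto
  also have "\<dots> < 8.075566326 * (1 + 0.000001)"
    by simp
  also have "\<dots> \<le> exp 2.088843 * exp 0.000001"
    by (intro mult_mono exp_2088843_bounds exp_ge_add_one_self) auto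
  also have "\<dots> = exp 2.088844"
    by (simp flip: exp_add)
  finally have "exp (- a) < exp 2.088844"
    by (simp only: fromroot(2))
  then have a2: "- a < 2.088844"
    by simp
  have uniq: "z = Complex a b" if z: "char_root z" "Im z > 0" "exp (- Re z) < 12" for z
  proof -
    define x y where "x = Re z" and "y = Im z"
    have zxy: "z = Complex x y"
      by (simp add: x_def y_def)
    have y: "y > 0" "char_root (Complex x y)"
      using z by (simp_all add: x_def y_def)
    note r = char_root_imp_root_fun[OF y(2,1)]
    \<comment> \<open>Since 0 < sin y \<le> 1, the imaginary part is at most
      \<open>y / sin y\<close>, which is \<open>exp (- Re z)\<close>.\<close>
    have "y * 1 \<le> y / sin y * 1"
      using r(1) y(1) by (simp add: field_simps)
    then have "y < 12"
      using z(3) r(2) by (simp add: x_def)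
    then have y4: "y < 4 * pi"
      using pi_gt3 by simp
    have "\<not> y < pi"
      using root_fun_neg[of y] r(4) y by auto
    moreover have "\<not> (pi \<le> y \<and> y \<le> 2 * pi)"
      using sin_le_zero[of y] r(1) by (cases "y = 2 * pi") auto
    moreover have "\<not> 3 * pi \<le> y"
      using sin_le_zero[of "y - 2 * pi"] y4 r(1) by (auto simp: sin_diff)
    ultimately have y3: "2 * pi < y" "y < 3 * pi"
      by linarith+
    have "y = b"
    proof (rule ccontr)
      assume "y \<noteq> b"
      then consider "y < b" | "b < y"
        by linarith
      then show False
      proof cases
        case 1
        then have "root_fun b < root_fun y"
          using y3 b2 y by (intro root_fun_decreasing pos) auto
        then show False
          using r(4) b(3) by simp
      next
        case 2
        then have "root_fun y < root_fun b"
          using y3 b2 by (intro root_fun_decreasing pos) auto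
        then show False
          using r(4) b(3) by simp
      qed
    qed
    then show ?thesis
      using r(3) zxy a_def by simp
  qed
  have "z = Complex a b \<or> z = Complex a (- b)"
    if z: "char_root z" "z \<noteq> 0" "exp (- Re z) < 12" for z
  proof -
    consider "Im z > 0" | "Im z < 0" | "Im z = 0"
      by linarith
    then show ?thesis
    proof cases
      case 1
      then show ?thesis
        using uniq z by blast
    next
      case 2
      then have "cnj z = Complex a b"
        using uniq[of "cnj z"] z char_root_cnj by simp
      then show ?thesis
        by (metis complex_cnj complex_cnj_cnj)
    next
      case 3
      have "z = Complex (Re z) 0"
        using 3 by (simp add: complex_eq_iff)
      with z(1) have "exp (- Re z) = 1 + - Re z"
        using char_root_Complex_iff[of "Re z" 0] by (simp add: algebra_simps)
      then have "Re z = 0"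
        using exp_eq_one_plus_self_iff[of "- Re z"] by simp
      with 3 z(2) show ?thesis
        by (simp add: complex_eq_iff)
    qed
  qed
  then show thesis
    using that root a1 a2 b by force
qed

text \<open>A root with a larger real part would have a still smaller \<open>exp (- Re z)\<close>,
  hence fall in the range where the nonzero roots are known. So the greatest real part exists and is
  that of the root found.\<close>

lemma alpha1_root:
  obtains \<beta> where "char_root (Complex alpha1 \<beta>)" "2.088843 \<le> - alpha1" "- alpha1 < 2.088844"
    "7.461489 \<le> \<beta>" "\<beta> < 7.461490"
    "\<And>z. char_root z \<Longrightarrow> z \<noteq> 0 \<Longrightarrow> exp (- Re z) < 12 \<Longrightarrow> z = Complex alpha1 \<beta> \<or> z = Complex alpha1 (- \<beta>)"
proof -
  obtain a b where ab: "char_root (Complex a b)" "2.088843 \<le> - a" "- a < 2.088844"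
    "7.461489 \<le> b" "b < 7.461490"
    "\<And>z. char_root z \<Longrightarrow> z \<noteq> 0 \<Longrightarrow> exp (- Re z) < 12 \<Longrightarrow> z = Complex a b \<or> z = Complex a (- b)"
    using ex_dominant_root by blast
  have "exp (- a) \<le> exp 2.088844"
    using ab(3) by simp
  also note exp_2088844_less
  finally have e: "exp (- a) < 12"
    by simp
  have "alpha1 = a"
    unfolding alpha1_def
  proof (rule Greatest_equality)
    show "\<exists>z. z \<noteq> 0 \<and> char_root z \<and> Re z = a"
      using ab by (intro exI[of _ "Complex a b"]) (auto simp: complex_eq_iff)
    fix y assume "\<exists>z. z \<noteq> 0 \<and> char_root z \<and> Re z = y"
    then obtain z where z: "z \<noteq> 0" "char_root z" "Re z = y"
      by blast
    show "y \<le> a"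
    proof (rule ccontr)
      assume "\<not> y \<le> a"
      then have "exp (- Re z) < exp (- a)"
        using z by simp
      with e have "exp (- Re z) < 12"
        by linarith
      with ab(6)[OF z(2,1)] z(3) \<open>\<not> y \<le> a\<close> show False
        by auto
    qed
  qed
  with ab that show thesis
    by blast
qed

section \<open>Asymptotics of the renewal function\<close>

definition renewal_fun :: "real \<Rightarrow> real" where
  "renewal_fun t = (\<Sum>k\<le>nat \<lfloor>t\<rfloor>. (- 1) ^ k * (t - real k) ^ k * exp (t - real k) / fact k)"

text \<open>The series \<open>A\<close> is the geometric series \<Sum> E^j B. As \<open>E\<close>
  has no constant term, E^j starts in degree j, so cutting the sum at j = n leaves the coefficient
  of degree n exact.\<close>

lemma fps_geometric_unique:
  fixes A B E :: "'a::comm_ring_1 fps"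
  assumes E: "fps_nth E 0 = 0"
    and A: "\<And>n. fps_nth A n = (\<Sum>j\<le>n. fps_nth (E ^ j * B) n)"
  shows "A * (1 - E) = B"
proof (rule fps_ext)
  fix n
  define S where "S = (\<Sum>j\<le>n. E ^ j * B)"
  have zero: "fps_nth (E ^ j * B) m = 0" if "m < j" for m j
  proof -
    have "fps_nth (E ^ j) i = 0" if "i \<le> m" for i
      using startsby_zero_power_prefix[OF E] that \<open>m < j\<close> by (metis le_less_trans)
    then show ?thesis
      by (simp add: fps_mult_nth)
  qed
  have AS: "fps_nth A m = fps_nth S m" if "m \<le> n" for m
  proof -
    have "fps_nth S m = (\<Sum>j\<le>n. fps_nth (E ^ j * B) m)"
      by (simp add: S_def fps_sum_nth)
    also have "\<dots> = (\<Sum>j\<le>m. fps_nth (E ^ j * B) m)"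
      using that by (intro sum.mono_neutral_right) (auto intro: zero)
    finally show ?thesis
      by (simp add: A)
  qed
  have "fps_nth (A * (1 - E)) n = fps_nth (S * (1 - E)) n"
    unfolding fps_mult_nth by (intro sum.cong) (auto simp: AS)
  also have "S * (1 - E) = (1 - E) * (\<Sum>j\<le>n. E ^ j) * B"
    unfolding S_def sum_distrib_right[symmetric] by (simp only: mult_ac)
  also have "\<dots> = B - E ^ Suc n * B"
    by (subst sum_gp_basic) (simp only: left_diff_distrib mult_1_left)
  also have "fps_nth \<dots> n = fps_nth B n"
    using zero[of n "Suc n"] by simp
  finally show "fps_nth (A * (1 - E)) n = fps_nth B n" .
qed

lemma renewal_fun_generating_function:
  assumes s: "0 \<le> s" "s < 1"
  shows "(\<lambda>z. exp (of_real s * (1 - z)) / (1 - z * exp (1 - z)))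
           has_fps_expansion Abs_fps (\<lambda>n. complex_of_real (renewal_fun (real n + s)))"
    (is "_ has_fps_expansion ?A")
proof -
  \<comment> \<open>\<open>E\<close> expands z e^(1-z) and \<open>B\<close> expands e^(s(1-z)). The
    coefficient of E^j B in degree n is the summand of the renewal function at n + s with k = n -
    j.\<close>
  define E :: "complex fps" where "E = fps_const (exp 1) * (fps_X * fps_exp (- 1))"
  define B :: "complex fps" where "B = fps_const (exp (of_real s)) * fps_exp (- of_real s)"
  have EB: "fps_nth (E ^ j * B) n = exp (of_real (real j + s)) * (- of_real (real j + s)) ^ (n - j) / fact (n - j)"
    if "j \<le> n" for j n
  proof -
    have "E ^ j * B = fps_const (exp (of_real (real j + s))) * (fps_X ^ j * fps_exp (- of_real (real j + s)))"
      by (simp add: E_def B_def power_mult_distrib fps_exp_power_mult exp_add mult_ac fps_const_power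
          flip: fps_exp_add_mult fps_const_mult exp_of_nat_mult)
    then show ?thesis
      using that by (simp add: fps_X_power_mult_nth)
  qed
  have "fps_nth ?A n = (\<Sum>j\<le>n. fps_nth (E ^ j * B) n)" for n
  proof -
    \<comment> \<open>Here s < 1 matters: the range of the sum depends on n alone, so for fixed s
      the values form a convolution.\<close>
    have fl: "nat \<lfloor>real n + s\<rfloor> = n"
      using s by linarith
    have "renewal_fun (real n + s)
        = (\<Sum>k\<le>n. (- 1) ^ k * (real n + s - real k) ^ k * exp (real n + s - real k) / fact k)"
      unfolding renewal_fun_def fl ..
    also have "\<dots> = (\<Sum>j\<le>n. exp (real j + s) * (- (real j + s)) ^ (n - j) / fact (n - j))"
    proof (rule sum.reindex_bij_witness[where i = "\<lambda>j. n - j" and j = "\<lambda>j. n - j"])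
      fix k assume "k \<in> {..n}"
      then have k: "n - (n - k) = k" "real (n - k) + s = real n + s - real k"
        by auto
      show "exp (real (n - k) + s) * (- (real (n - k) + s)) ^ (n - (n - k)) / fact (n - (n - k))
          = (- 1) ^ k * (real n + s - real k) ^ k * exp (real n + s - real k) / fact k"
        unfolding k by (subst power_minus) (simp only: mult_ac)
    qed auto
    also have "complex_of_real \<dots> = (\<Sum>j\<le>n. fps_nth (E ^ j * B) n)"
      by (simp add: EB flip: exp_of_real)
    finally show ?thesis
      by simp
  qed
  then have "?A * (1 - E) = B"
    by (intro fps_geometric_unique) (auto simp: E_def)
  moreover have nz: "fps_nth (1 - E) 0 \<noteq> 0"
    by (simp add: E_def)
  ultimately have A: "?A = B / (1 - E)"
    by (metis fps_divide_times_eq fps_zero_nth)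
  have "(\<lambda>z. exp (of_real s) * exp (- of_real s * z) / (1 - exp 1 * (z * exp (- 1 * z)))) has_fps_expansion B / (1 - E)"
    using nz unfolding B_def E_def by (intro fps_expansion_intros)
  also have "(\<lambda>z::complex. exp (of_real s) * exp (- of_real s * z) / (1 - exp 1 * (z * exp (- 1 * z))))
     = (\<lambda>z. exp (of_real s * (1 - z)) / (1 - z * exp (1 - z)))"
    by (auto simp: fun_eq_iff right_diff_distrib exp_diff exp_minus field_simps)
  finally show ?thesis
    unfolding A .
qed

section \<open>Expansions of poles and bounds for coefficients\<close>

lemma has_fps_expansion_simple_pole:
  fixes p :: complex
  assumes "p \<noteq> 0"
  shows "(\<lambda>z. 1 / (z - p)) has_fps_expansion Abs_fps (\<lambda>n. - ((1 / p) ^ Suc n))" (is "_ has_fps_expansion ?F")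
proof -
  have "?F * (fps_X - fps_const p) = 1"
  proof (rule fps_ext)
    fix n
    show "fps_nth (?F * (fps_X - fps_const p)) n = fps_nth 1 n"
      using assms by (cases n) (simp_all add: right_diff_distrib)
  qed
  moreover have "fps_nth (fps_X - fps_const p) 0 \<noteq> 0"
    using assms by simp
  ultimately have "?F = 1 / (fps_X - fps_const p)"
    by (metis fps_divide_times_eq fps_zero_nth)
  moreover have "(\<lambda>z. 1 / (z - p)) has_fps_expansion 1 / (fps_X - fps_const p)"
    using assms by (intro fps_expansion_intros) simp
  ultimately show ?thesis
    by simp
qed

text \<open>Riemann's theorem removes one point at a time. The extension across \<open>p\<close>
  agrees with \<open>f\<close> near each remaining point, apart from that point, so it inherits the
  limit conditions there.\<close>

lemma holomorphic_extend_finite: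
  assumes "finite T" "open S" "T \<subseteq> S" "f holomorphic_on S - T"
    and "\<And>p. p \<in> T \<Longrightarrow> ((\<lambda>z. (z - p) * f z) \<longlongrightarrow> 0) (at p)"
  shows "\<exists>g. g holomorphic_on S \<and> (\<forall>z\<in>S - T. g z = f z)"
  using assms(1,3-)
proof (induction T arbitrary: f rule: finite_induct)
  case empty
  then show ?case
    by auto
next
  case (insert p T)
  let ?S = "S - T"
  have "p \<in> interior ?S"
    using assms(2) insert by (subst interior_open) (auto intro!: open_Diff finite_imp_closed)
  moreover have "f holomorphic_on ?S - {p}"
    using insert.prems(2) by (metis Diff_insert)
  ultimately obtain h where h: "h holomorphic_on ?S" "\<And>z. z \<in> ?S - {p} \<Longrightarrow> h z = f z"
    using holomorphic_on_extend_lim[of f ?S p] insert.prems(3)[of p] by auto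
  have "((\<lambda>z. (z - q) * h z) \<longlongrightarrow> 0) (at q)" if q: "q \<in> T" for q
  proof -
    have "eventually (\<lambda>z. z \<in> S - (insert p T - {q})) (nhds q)"
      using insert q assms(2)
      by (intro eventually_nhds_in_open open_Diff finite_imp_closed) auto
    then have "eventually (\<lambda>z. (z - q) * f z = (z - q) * h z) (at q)"
      unfolding eventually_at_filter by eventually_elim (use h(2) in auto)
    with insert.prems(3)[of q] q show ?thesis
      by (auto intro: Lim_transform_eventually)
  qed
  then obtain g where "g holomorphic_on S" "\<And>z. z \<in> ?S \<Longrightarrow> g z = h z"
    using insert.IH[OF _ h(1)] insert.prems(1) by auto
  with h(2) show ?case
    by (intro exI[of _ g]) auto
qed

text \<open>The holomorphic extension has the same expansion, since 0 is not in \<open>T\<close>,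
  and agrees with \<open>f\<close> on the circle of radius \<open>r\<close>, since \<open>T\<close>
  lies strictly inside. Cauchy's inequality then applies to the extension.\<close>

lemma fps_coeff_bound_removable:
  assumes f: "f has_fps_expansion F" and T: "finite T" "T \<subseteq> ball 0 r" "0 \<notin> T"
    and hol: "f holomorphic_on ball 0 R - T" and r: "0 < r" "r < R"
    and lim: "\<And>p. p \<in> T \<Longrightarrow> ((\<lambda>z. (z - p) * f z) \<longlongrightarrow> 0) (at p)"
    and bound: "\<And>z. norm z = r \<Longrightarrow> norm (f z) \<le> B"
  shows "norm (fps_nth F n) \<le> B / r ^ n"
proof -
  have "T \<subseteq> ball 0 R"
    using T(2) r by (auto simp: subset_iff)
  then obtain g where g: "g holomorphic_on ball 0 R" "\<And>z. z \<in> ball 0 R - T \<Longrightarrow> g z = f z"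
    using holomorphic_extend_finite[OF T(1) open_ball _ hol lim] by blast
  have "eventually (\<lambda>z. z \<in> ball 0 R - T) (nhds 0)"
    using T r by (intro eventually_nhds_in_open open_Diff finite_imp_closed) auto
  then have "eventually (\<lambda>z. g z = f z) (nhds 0)"
    by eventually_elim (use g(2) in auto)
  with f have "g has_fps_expansion F"
    by (subst has_fps_expansion_cong) auto
  then have "norm (fps_nth F n) = norm ((deriv ^^ n) g 0) / fact n"
    by (simp add: fps_nth_fps_expansion norm_divide)
  also have "norm ((deriv ^^ n) g 0) \<le> fact n * B / r ^ n"
  proof (rule Cauchy_inequality)
    show "g holomorphic_on ball 0 r"
      using g(1) r by (elim holomorphic_on_subset) auto
    show "continuous_on (cball 0 r) g"
      using g(1) r by (intro holomorphic_on_imp_continuous_on) (auto elim!: holomorphic_on_subset)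
    fix z :: complex assume "norm (0 - z) = r"
    then have "z \<in> ball 0 R - T" "norm z = r"
      using r T(2) by auto
    then show "norm (g z) \<le> B"
      using g(2) bound by simp
  qed (use r in auto)
  finally show ?thesis
    by (simp add: divide_right_mono)
qed

section \<open>Zeros of the denominator and principal parts\<close>

definition gf_denom :: "complex \<Rightarrow> complex" where
  "gf_denom z = 1 - z * exp (1 - z)"

lemma gf_denom_eq_0_iff: "gf_denom z = 0 \<longleftrightarrow> char_root (1 - z)"
proof -
  have "gf_denom z = exp (1 - z) * (exp (z - 1) - z)"
    by (simp add: gf_denom_def right_diff_distrib flip: exp_add)
  also have "exp (z - 1) - z = 1 - z - 1 + exp (- (1 - z))"
    by simp
  finally show ?thesis
    by (simp add: char_root_def)
qed

lemma char_root_norm: "char_root z \<Longrightarrow> norm (1 - z) = exp (- Re z)"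
proof -
  assume "char_root z"
  then have "1 - z = exp (- z)"
    by (simp add: char_root_def algebra_simps)
  then show ?thesis
    by simp
qed

lemma gf_denom_has_derivative:
  "(gf_denom has_field_derivative (z - 1) * exp (1 - z)) (at z)"
  unfolding gf_denom_def by (auto intro!: derivative_eq_intros simp: algebra_simps)

text \<open>At a zero, p e^(1-p) = 1 turns the derivative (p-1) e^(1-p) into (p-1)/p. The limit is
  its reciprocal, which provides the residue of the generating function.\<close>

lemma gf_denom_simple_zero:
  assumes "gf_denom p = 0" "p \<noteq> 1"
  shows "((\<lambda>z. (z - p) / gf_denom z) \<longlongrightarrow> p / (p - 1)) (at p)"
proof -
  have "p * exp (1 - p) = 1"
    using assms by (simp add: gf_denom_def)
  moreover from this have "p \<noteq> 0"
    by auto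
  ultimately have e: "exp (1 - p) = 1 / p" "p \<noteq> 0"
    by (simp_all add: eq_divide_eq mult.commute)
  have "((\<lambda>z. (gf_denom z - gf_denom p) / (z - p)) \<longlongrightarrow> (p - 1) * exp (1 - p)) (at p)"
    using gf_denom_has_derivative[of p] by (simp add: has_field_derivative_iff)
  then have "((\<lambda>z. inverse (gf_denom z / (z - p))) \<longlongrightarrow> inverse ((p - 1) / p)) (at p)"
    using assms e by (intro tendsto_inverse) auto
  then show ?thesis
    by simp
qed

text \<open>With w = z - 1 the Laurent expansion begins 2/w^2 + (4/3 - 2s)/w. After multiplication
  by w^2 it is analytic, and the claim amounts to its value and first derivative at 0.\<close>

lemma gf_double_pole:
  fixes s :: complex
  shows "((\<lambda>z. (z - 1) * (exp (s * (1 - z)) / gf_denom z - 2 * (1 / (z - 1))\<^sup>2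
            + (2 * s - 4 / 3) * (1 / (z - 1)))) \<longlongrightarrow> 0) (at 1)"
proof -
  define P :: "complex fps" where "P = 1 - (1 + fps_X) * fps_exp (- 1)"
  \<comment> \<open>The factor \<open>fps_X ^ 2\<close> matches the order of \<open>P\<close>, so
    that N / P is a quotient of series of equal order. Comparing the coefficients 2 and 3 in H P = N
    gives the first two coefficients of \<open>H\<close>.\<close>
  define N :: "complex fps" where "N = fps_X ^ 2 * fps_exp (- s)"
  define H where "H = N / P"
  have P: "fps_nth P 0 = 0" "fps_nth P 1 = 0" "fps_nth P 2 = 1 / 2" "fps_nth P 3 = - 1 / 3"
    by (simp_all add: P_def distrib_right eval_nat_numeral)
  then have sP: "subdegree P = 2"
    by (intro subdegreeI) (auto simp: less_2_cases_iff)
  have N: "fps_nth N 2 = 1" "fps_nth N 3 = - s" "fps_nth N 0 = 0" "fps_nth N 1 = 0"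
    by (simp_all add: N_def fps_X_power_mult_nth)
  then have sN: "subdegree N = 2"
    by (intro subdegreeI) (auto simp: less_2_cases_iff)
  have "P \<noteq> 0"
    using sP by auto
  then have HP: "H * P = N"
    unfolding H_def by (intro fps_times_divide_eq) (simp_all add: sP sN)
  have "fps_nth (H * P) 2 = fps_nth H 0 / 2"
    using P by (simp add: fps_mult_nth numeral_2_eq_2)
  then have H0: "fps_nth H 0 = 2"
    using HP N by simp
  have "fps_nth (H * P) 3 = - fps_nth H 0 / 3 + fps_nth H 1 / 2"
    using P by (simp add: fps_mult_nth eval_nat_numeral)
  then have H1: "fps_nth H 1 = 4 / 3 - 2 * s"
    using HP N H0 by (simp add: field_simps)
  \<comment> \<open>The value 2 at 0 is the constant coefficient of \<open>H\<close>; it fills the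
    removable singularity and makes \<open>h\<close> analytic there.\<close>
  define h where "h = (\<lambda>w. if w = 0 then 2 else w ^ 2 * exp (- s * w) / (1 - (1 + w) * exp (- 1 * w)))"
  have "h has_fps_expansion H"
    unfolding h_def H_def
  proof (rule has_fps_expansion_divide)
    show "(\<lambda>w. w ^ 2 * exp (- s * w)) has_fps_expansion N"
      unfolding N_def by (intro fps_expansion_intros)
    show "(\<lambda>w. 1 - (1 + w) * exp (- 1 * w)) has_fps_expansion P"
      unfolding P_def by (intro fps_expansion_intros)
  qed (use \<open>P \<noteq> 0\<close> in \<open>simp_all add: sP sN P N\<close>)
  then have "fps_nth H 1 = deriv h 0" and "h analytic_on {0}"
    using fps_nth_fps_expansion[of h H 1] has_fps_expansion_imp_analytic_0 by auto
  then have "(h has_field_derivative fps_nth H 1) (at 0)"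
    by (simp add: analytic_derivI)
  then have "((\<lambda>w. (h w - 2) / w) \<longlongrightarrow> 4 / 3 - 2 * s) (at 0)"
    unfolding has_field_derivative_iff H1 by (simp add: h_def)
  then have "((\<lambda>w. (h w - 2) / w + (2 * s - 4 / 3)) \<longlongrightarrow> (4 / 3 - 2 * s) + (2 * s - 4 / 3)) (at 0)"
    by (intro tendsto_intros)
  then have lim: "((\<lambda>w. (h w - 2) / w + (2 * s - 4 / 3)) \<longlongrightarrow> 0) (at 0)"
    by simp
  have "eventually (\<lambda>w. (h w - 2) / w + (2 * s - 4 / 3)
     = w * (exp (s * (1 - (w + 1))) / gf_denom (w + 1) - 2 * (1 / w)\<^sup>2 + (2 * s - 4 / 3) * (1 / w))) (at 0)"
    unfolding eventually_at_filter
  proof (rule always_eventually, intro allI impI)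
    fix w :: complex assume "w \<noteq> 0"
    then have "(w\<^sup>2 * e / d - 2) / w + k = w * (e / d - 2 * (1 / w)\<^sup>2 + k * (1 / w))" for e d k
      by (cases "d = 0") (simp_all add: field_simps power2_eq_square)
    moreover have "exp (s * (1 - (w + 1))) = exp (- s * w)" "gf_denom (w + 1) = 1 - (1 + w) * exp (- 1 * w)"
      by (simp_all add: gf_denom_def add.commute)
    ultimately show "(h w - 2) / w + (2 * s - 4 / 3)
     = w * (exp (s * (1 - (w + 1))) / gf_denom (w + 1) - 2 * (1 / w)\<^sup>2 + (2 * s - 4 / 3) * (1 / w))"
      using \<open>w \<noteq> 0\<close> by (simp only: h_def if_False)
  qed
  with lim have "((\<lambda>w. w * (exp (s * (1 - (w + 1))) / gf_denom (w + 1) - 2 * (1 / w)\<^sup>2 + (2 * s - 4 / 3) * (1 / w))) \<longlongrightarrow> 0) (at 0)"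
    by (rule Lim_transform_eventually)
  then show ?thesis
    by (subst at_to_0) (simp add: filterlim_filtermap add.commute)
qed

lemma renewal_fun_asymptotics:
  "\<exists>C. \<forall>t\<ge>0. \<bar>renewal_fun t - (2 * t + 2 / 3)\<bar> \<le> C * exp (alpha1 * t)"
proof -
  obtain \<beta> where \<beta>: "char_root (Complex alpha1 \<beta>)" "2.088843 \<le> - alpha1" "- alpha1 < 2.088844"
      "7.461489 \<le> \<beta>" "\<beta> < 7.461490"
      "\<And>z. char_root z \<Longrightarrow> z \<noteq> 0 \<Longrightarrow> exp (- Re z) < 12 \<Longrightarrow> z = Complex alpha1 \<beta> \<or> z = Complex alpha1 (- \<beta>)"
    using alpha1_root by blast
  \<comment> \<open>The two conjugate simple poles, obtained from the dominant roots by \<lambda> ->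
    1 - \<lambda>.\<close>
  define u v where "u = 1 - Complex alpha1 \<beta>" and "v = 1 - Complex alpha1 (- \<beta>)"
  have "char_root (Complex alpha1 (- \<beta>))"
    using char_root_cnj[OF \<beta>(1)] by (simp add: complex_cnj)
  then have zero: "gf_denom u = 0" "gf_denom v = 0" and norm_uv: "norm u = exp (- alpha1)" "norm v = exp (- alpha1)"
    using \<beta>(1) char_root_norm[of "Complex alpha1 \<beta>"] char_root_norm[of "Complex alpha1 (- \<beta>)"]
    by (simp_all add: u_def v_def gf_denom_eq_0_iff)
  have distinct: "u \<noteq> v" "u \<noteq> 1" "v \<noteq> 1" "u \<noteq> 0" "v \<noteq> 0"
    using \<beta>(4) by (auto simp: u_def v_def complex_eq_iff)
  have "exp (- alpha1) < exp 2.088844"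
    using \<beta>(3) by simp
  also note exp_2088844_less
  finally have rho: "exp (- alpha1) < 10" .
  have zeros: "z \<in> {1, u, v}" if "gf_denom z = 0" "norm z < 12" for z
  proof -
    have r: "char_root (1 - z)"
      using that by (simp add: gf_denom_eq_0_iff)
    then have "exp (- Re (1 - z)) < 12"
      using char_root_norm[of "1 - z"] that(2) by simp
    then show ?thesis
      using \<beta>(6)[OF r] by (auto simp: u_def v_def algebra_simps)
  qed
  \<comment> \<open>\<open>c p s\<close> is the residue at a simple pole \<open>p\<close>, and
    \<open>K s\<close> is the generating function with all principal parts in the disc of radius 12
    subtracted.\<close>
  define c where "c = (\<lambda>(p::complex) (s::real). exp (of_real s * (1 - p)) * (p / (p - 1)))"
  define K where "K = (\<lambda>s z. exp (of_real s * (1 - z)) / gf_denom z - 2 * (1 / (z - 1))\<^sup>2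
      + (2 * of_real s - 4 / 3) * (1 / (z - 1)) - c u s * (1 / (z - u)) - c v s * (1 / (z - v)))"
  have hol: "K s holomorphic_on ball 0 12 - {1, u, v}" for s
    unfolding K_def gf_denom_def using zeros[unfolded gf_denom_def]
    by (intro holomorphic_intros) auto
  \<comment> \<open>Stated for an arbitrary pair \<open>p\<close>, \<open>q\<close>, so that
    exchanging \<open>u\<close> and \<open>v\<close> settles both poles. The function
    \<open>g\<close> below collects the terms that are regular at \<open>p\<close>.\<close>
  have lim_uv: "((\<lambda>z. (z - p) * (exp (of_real s * (1 - z)) / gf_denom z - 2 * (1 / (z - 1))\<^sup>2
      + (2 * of_real s - 4 / 3) * (1 / (z - 1)) - c p s * (1 / (z - p)) - c q s * (1 / (z - q)))) \<longlongrightarrow> 0) (at p)"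
    if "gf_denom p = 0" "p \<noteq> 1" "p \<noteq> q" for p q s
  proof -
    define g where "g = (\<lambda>z. (2 * of_real s - 4 / 3) * (1 / (z - 1)) - 2 * (1 / (z - 1))\<^sup>2 - c q s * (1 / (z - q)))"
    have "isCont g p"
      unfolding g_def using that by (intro continuous_intros) auto
    then have "((\<lambda>z. exp (of_real s * (1 - z)) * ((z - p) / gf_denom z) - c p s + (z - p) * g z) \<longlongrightarrow>
       exp (of_real s * (1 - p)) * (p / (p - 1)) - c p s + (p - p) * g p) (at p)"
      using that by (intro tendsto_intros gf_denom_simple_zero) (auto simp: isCont_def)
    then have "((\<lambda>z. exp (of_real s * (1 - z)) * ((z - p) / gf_denom z) - c p s + (z - p) * g z) \<longlongrightarrow> 0) (at p)"
      by (simp add: c_def)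
    moreover have "eventually (\<lambda>z. exp (of_real s * (1 - z)) * ((z - p) / gf_denom z) - c p s + (z - p) * g z
      = (z - p) * (exp (of_real s * (1 - z)) / gf_denom z - 2 * (1 / (z - 1))\<^sup>2
          + (2 * of_real s - 4 / 3) * (1 / (z - 1)) - c p s * (1 / (z - p)) - c q s * (1 / (z - q)))) (at p)"
      unfolding eventually_at_filter
    proof (rule always_eventually, intro allI impI)
      fix z assume "z \<noteq> p"
      then have "(z - p) * (c p s * (1 / (z - p))) = c p s"
        by simp
      then show "exp (of_real s * (1 - z)) * ((z - p) / gf_denom z) - c p s + (z - p) * g z
      = (z - p) * (exp (of_real s * (1 - z)) / gf_denom z - 2 * (1 / (z - 1))\<^sup>2
          + (2 * of_real s - 4 / 3) * (1 / (z - 1)) - c p s * (1 / (z - p)) - c q s * (1 / (z - q)))"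
        unfolding g_def by (simp only: algebra_simps times_divide_eq_right times_divide_eq_left)
    qed
    ultimately show ?thesis
      by (rule Lim_transform_eventually)
  qed
  have lim: "((\<lambda>z. (z - p) * K s z) \<longlongrightarrow> 0) (at p)" if p: "p \<in> {1, u, v}" for p s
  proof -
    consider "p = 1" | "p = u" | "p = v"
      using p by blast
    then show ?thesis
    proof cases
      case 1
      have "((\<lambda>z. (z - 1) * (exp (of_real s * (1 - z)) / gf_denom z - 2 * (1 / (z - 1))\<^sup>2
            + (2 * of_real s - 4 / 3) * (1 / (z - 1)))
            - (z - 1) * (c u s * (1 / (z - u)) + c v s * (1 / (z - v))))
            \<longlongrightarrow> 0 - (1 - 1) * (c u s * (1 / (1 - u)) + c v s * (1 / (1 - v)))) (at 1)"
        using distinct by (intro tendsto_intros gf_double_pole) auto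
      then show ?thesis
        unfolding 1 K_def by (simp add: algebra_simps)
    next
      case 2
      show ?thesis
        unfolding 2 K_def using lim_uv[of u v s] zero distinct by simp
    next
      case 3
      show ?thesis
        unfolding 3 K_def using lim_uv[of v u s] zero distinct by (simp add: algebra_simps)
    qed
  qed
  \<comment> \<open>Compactness in both variables makes the bound uniform in \<open>s\<close>; the
    circle avoids the poles because their moduli are 1 and \<open>exp (- alpha1)\<close>, both below
    10.\<close>
  have "bounded ((\<lambda>(s, z). K s z) ` ({0..1} \<times> sphere 0 10))"
  proof (intro compact_imp_bounded compact_continuous_image compact_Times)
    have nz: "gf_denom z \<noteq> 0" "z \<noteq> 1" "z \<noteq> u" "z \<noteq> v" if "norm z = 10" for z
      using zeros[of z] rho norm_uv that by auto
    show "continuous_on ({0..1} \<times> sphere 0 10) (\<lambda>(s, z). K s z)"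
      unfolding K_def c_def case_prod_unfold gf_denom_def
      using nz distinct by (intro continuous_intros) (auto simp: gf_denom_def)
  qed auto
  then obtain B where B: "\<And>s z. s \<in> {0..1} \<Longrightarrow> norm z = 10 \<Longrightarrow> norm (K s z) \<le> B"
    unfolding bounded_iff by fastforce
  have "norm (K 0 10) \<le> B"
    by (rule B) auto
  then have "0 \<le> B"
    using norm_ge_zero order_trans by blast
  have "bounded ((\<lambda>s. norm (c u s) + norm (c v s)) ` {0..1})"
    unfolding c_def by (intro compact_imp_bounded compact_continuous_image continuous_intros) auto
  then obtain D where D: "\<And>s. s \<in> {0..1} \<Longrightarrow> norm (c u s) + norm (c v s) \<le> D"
    unfolding bounded_iff by fastforce
  have main: "\<bar>renewal_fun (real n + s) - (2 * (real n + s) + 2 / 3)\<bar> \<le> (B + D) * exp (alpha1 * real n)"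
    if s: "0 \<le> s" "s < 1" for n s
  proof -
    define A where "A = Abs_fps (\<lambda>n. complex_of_real (renewal_fun (real n + s)))"
    define S where "S = (\<lambda>p::complex. Abs_fps (\<lambda>n. - ((1 / p) ^ Suc n)))"
    define F where "F = A - fps_const 2 * (S 1)\<^sup>2 + fps_const (2 * of_real s - 4 / 3) * S 1
        - fps_const (c u s) * S u - fps_const (c v s) * S v"
    have "K s has_fps_expansion F"
      unfolding K_def F_def A_def S_def gf_denom_def power2_eq_square using s distinct
      by (intro fps_expansion_intros has_fps_expansion_simple_pole renewal_fun_generating_function) auto
    then have "norm (fps_nth F n) \<le> B / 10 ^ n"
      by (rule fps_coeff_bound_removable[where T = "{1, u, v}" and R = 12])
         (use hol lim B s distinct norm_uv rho in auto)
    also have "B / 10 ^ n \<le> B / exp (- alpha1) ^ n"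
      using rho \<open>0 \<le> B\<close> by (intro divide_left_mono power_mono) auto
    finally have F: "norm (fps_nth F n) \<le> B * exp (alpha1 * real n)"
      by (simp add: exp_minus field_simps flip: exp_of_nat_mult)
    have S1: "fps_nth ((S 1)\<^sup>2) n = of_nat (Suc n)"
      by (simp add: S_def power2_eq_square fps_mult_nth)
    \<comment> \<open>The double pole contributes 2(n+1) + (2s - 4/3) to the coefficient, which is
      exactly 2(n+s) + 2/3.\<close>
    have "of_real (renewal_fun (real n + s) - (2 * (real n + s) + 2 / 3))
        = fps_nth F n - c u s * (1 / u) ^ Suc n - c v s * (1 / v) ^ Suc n"
      unfolding F_def using S1 by (simp add: A_def S_def field_simps)
    also have "norm \<dots> \<le> norm (fps_nth F n) + norm (c u s * (1 / u) ^ Suc n) + norm (c v s * (1 / v) ^ Suc n)"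
      by norm
    also have "\<dots> = norm (fps_nth F n) + (norm (c u s) + norm (c v s)) * exp (alpha1 * real (Suc n))"
      by (simp add: norm_mult norm_power norm_divide norm_uv exp_minus distrib_right field_simps exp_add flip: exp_of_nat_mult)
    also have "\<dots> \<le> B * exp (alpha1 * real n) + D * exp (alpha1 * real n)"
    proof (intro add_mono F mult_mono D)
      have "0 \<le> norm (c u s) + norm (c v s)"
        by simp
      also have "\<dots> \<le> D"
        using D s by simp
      finally show "0 \<le> D" .
      show "exp (alpha1 * real (Suc n)) \<le> exp (alpha1 * real n)"
        using \<beta>(2) by (simp add: mult_left_mono_neg)
    qed (use s in auto)
    finally show ?thesis
      by (simp only: distrib_right norm_of_real)
  qed
  show ?thesis
  proof (intro exI allI impI)
    fix t :: real assume t: "t \<ge> 0"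
    define n s where "n = nat \<lfloor>t\<rfloor>" and "s = frac t"
    have ts: "t = real n + s" "0 \<le> s" "s < 1"
      using t frac_lt_1[of t] by (auto simp: n_def s_def frac_def)
    have "0 \<le> B + D"
      using main[of s n] ts by (metis abs_ge_zero exp_gt_zero order_trans zero_le_mult_iff not_le)
    \<comment> \<open>Passing from n to t costs the constant factor \<open>exp (- alpha1)\<close>,
      because s \<le> 1 and \<open>alpha1\<close> is negative.\<close>
    have "alpha1 * real n \<le> alpha1 * t - alpha1"
      using ts \<beta>(2) mult_left_mono_neg[of s 1 alpha1] by (simp add: algebra_simps)
    then have "(B + D) * exp (alpha1 * real n) \<le> (B + D) * exp (- alpha1 + alpha1 * t)"
      using \<open>0 \<le> B + D\<close> by (intro mult_left_mono) auto
    with main[OF ts(2,3), of n] show "\<bar>renewal_fun t - (2 * t + 2 / 3)\<bar> \<le> ((B + D) * exp (- alpha1)) * exp (alpha1 * t)"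
      unfolding exp_add ts(1)[symmetric] mult.assoc by (rule order_trans)
  qed
qed

section \<open>Moments of the counting function\<close>

definition trunc_power :: "nat \<Rightarrow> real \<Rightarrow> real" where
  "trunc_power n x = (if x \<ge> 0 then x ^ n else 0)"

definition irwin_hall :: "nat \<Rightarrow> real \<Rightarrow> real" where
  "irwin_hall n t = (\<Sum>k\<le>n. (- 1) ^ k * real (n choose k) * trunc_power n (t - real k)) / fact n"

lemma trunc_power_has_integral:
  "((\<lambda>x. trunc_power n (t - x)) has_integral
      (trunc_power (Suc n) t - trunc_power (Suc n) (t - 1)) / real (Suc n)) {0..1}"
proof -
  define G where "G = (\<lambda>x. - (trunc_power (Suc n) (t - x) / real (Suc n)))"
  have G: "G x = - ((max 0 (t - x)) ^ Suc n / real (Suc n))" for x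
    by (auto simp: G_def trunc_power_def max_def)
  have "((\<lambda>x. trunc_power n (t - x)) has_integral (G 1 - G 0)) {0..1}"
  proof (rule fundamental_theorem_of_calculus_interior_strong)
    \<comment> \<open>Only x = t is exceptional: there the integrand may jump (for n = 0), while
      \<open>G\<close> remains continuous.\<close>
    show "finite {t}" "(0::real) \<le> 1"
      by auto
    show "continuous_on {0..1} G"
      unfolding G by (intro continuous_intros) auto
    fix x assume x: "x \<in> {0<..<1} - {t}"
    show "(G has_vector_derivative trunc_power n (t - x)) (at x)"
    proof (cases "x < t")
      case True
      have "((\<lambda>x. - ((t - x) ^ Suc n / real (Suc n))) has_real_derivative (t - x) ^ n) (at x)"
        by (auto intro!: derivative_eq_intros simp: field_simps simp del: of_nat_Suc power_Suc)
      moreover have "eventually (\<lambda>y. G y = - ((t - y) ^ Suc n / real (Suc n))) (nhds x)"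
        using eventually_nhds_in_open[of "{..<t}" x] True by (auto elim!: eventually_mono simp: G)
      ultimately have "(G has_real_derivative (t - x) ^ n) (at x)"
        by (subst DERIV_cong_ev[OF refl _ refl]) auto
      then show ?thesis
        using True by (simp add: trunc_power_def has_real_derivative_iff_has_vector_derivative)
    next
      case False
      with x have "x > t"
        by auto
      have "eventually (\<lambda>y. G y = 0) (nhds x)"
        using eventually_nhds_in_open[of "{t<..}" x] \<open>x > t\<close> by (auto elim!: eventually_mono simp: G)
      then have "(G has_real_derivative 0) (at x)"
        by (subst DERIV_cong_ev[OF refl _ refl]) auto
      then show ?thesis
        using \<open>x > t\<close> by (simp add: trunc_power_def has_real_derivative_iff_has_vector_derivative)
    qed
  qed
  also have "G 1 - G 0 = (trunc_power (Suc n) t - trunc_power (Suc n) (t - 1)) / real (Suc n)"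
    by (simp add: G_def diff_divide_distrib)
  finally show ?thesis .
qed

text \<open>Convolution with the uniform law on (0,1). Each truncated power integrates to a
  difference of neighbouring ones, and Pascal's rule merges the two resulting sums.\<close>

lemma irwin_hall_has_integral:
  "((\<lambda>x. irwin_hall n (t - x)) has_integral irwin_hall (Suc n) t) {0..1}"
proof -
  let ?g = "\<lambda>k. trunc_power (Suc n) (t - real k)"
  have "((\<lambda>x. (\<Sum>k\<le>n. (- 1) ^ k * real (n choose k) * trunc_power n (t - real k - x)) / fact n) has_integral
     (\<Sum>k\<le>n. (- 1) ^ k * real (n choose k) * ((?g k - trunc_power (Suc n) (t - real k - 1)) / real (Suc n))) / fact n) {0..1}"
    by (intro has_integral_divide has_integral_sum has_integral_mult_right trunc_power_has_integral) auto
  also have "(\<lambda>x. (\<Sum>k\<le>n. (- 1) ^ k * real (n choose k) * trunc_power n (t - real k - x)) / fact n) = (\<lambda>x. irwin_hall n (t - x))"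
    by (simp add: irwin_hall_def algebra_simps)
  also have "(\<Sum>k\<le>n. (- 1) ^ k * real (n choose k) * ((?g k - trunc_power (Suc n) (t - real k - 1)) / real (Suc n))) / fact n
     = (\<Sum>k\<le>n. (- 1) ^ k * real (n choose k) * (?g k - ?g (Suc k))) / fact (Suc n)"
    by (simp add: sum_divide_distrib algebra_simps)
  also have "(\<Sum>k\<le>n. (- 1) ^ k * real (n choose k) * (?g k - ?g (Suc k)))
     = (\<Sum>k\<le>n. (- 1) ^ k * real (n choose k) * ?g k) + (\<Sum>k\<le>n. (- 1) ^ Suc k * real (n choose k) * ?g (Suc k))"
    by (simp add: algebra_simps sum.distrib sum_subtractf sum_negf)
  also have "(\<Sum>k\<le>n. (- 1) ^ k * real (n choose k) * ?g k) = (\<Sum>k\<le>Suc n. (- 1) ^ k * real (n choose k) * ?g k)"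
    by simp
  also have "\<dots> = ?g 0 + (\<Sum>k\<le>n. (- 1) ^ Suc k * real (n choose Suc k) * ?g (Suc k))"
    by (subst sum.atMost_Suc_shift) simp
  also have "\<dots> + (\<Sum>k\<le>n. (- 1) ^ Suc k * real (n choose k) * ?g (Suc k))
     = ?g 0 + (\<Sum>k\<le>n. (- 1) ^ Suc k * real (Suc n choose Suc k) * ?g (Suc k))"
    unfolding add.assoc sum.distrib[symmetric]
    by (intro arg_cong2[where f = "(+)"] sum.cong) (auto simp: algebra_simps)
  also have "\<dots> = (\<Sum>k\<le>Suc n. (- 1) ^ k * real (Suc n choose k) * ?g k)"
    by (subst sum.atMost_Suc_shift) simp
  finally show ?thesis
    by (simp add: irwin_hall_def)
qed

text \<open>Cancelling factorials and shifting n by k leaves x^k/k! times the exponential series. In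
  the weighted sum the weight n + k after the shift splits into k, giving k e^x, and n, giving x
  e^x.\<close>

lemma exp_series_shifted:
  fixes x :: real
  shows "(\<lambda>n. real (n choose k) * x ^ n / fact n) sums (x ^ k * exp x / fact k)"
    and "(\<lambda>n. real n * (real (n choose k) * x ^ n / fact n)) sums ((real k + x) * (x ^ k * exp x / fact k))"
proof -
  have ch: "real ((n + k) choose k) * x ^ (n + k) / fact (n + k) = x ^ k / fact k * (x ^ n / fact n)" for n
    by (subst binomial_fact) (auto simp: power_add field_simps)
  have e: "(\<lambda>n. x ^ n / fact n) sums exp x"
    using exp_converges[of x] by (simp add: field_simps)
  then have "(\<lambda>n. x ^ k / fact k * (x ^ n / fact n)) sums (x ^ k / fact k * exp x)"
    by (rule sums_mult)
  then have "(\<lambda>n. real ((n + k) choose k) * x ^ (n + k) / fact (n + k)) sums (x ^ k * exp x / fact k)"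
    by (simp only: ch) simp
  then show "(\<lambda>n. real (n choose k) * x ^ n / fact n) sums (x ^ k * exp x / fact k)"
    by (subst sums_iff_shift'[of _ k, symmetric]) (simp add: binomial_eq_0)
  have "(\<lambda>n. real (Suc n) * (x ^ Suc n / fact (Suc n))) sums (x * exp x)"
    using sums_mult[OF e, of x] by (simp add: field_simps del: of_nat_Suc)
  then have "(\<lambda>n. real n * (x ^ n / fact n)) sums (x * exp x)"
    by (subst (asm) sums_Suc_iff) simp
  from sums_mult[OF sums_add[OF sums_mult[OF e, of "real k"] this], of "x ^ k / fact k"]
  have "(\<lambda>n. real (n + k) * (real ((n + k) choose k) * x ^ (n + k) / fact (n + k))) sums ((real k + x) * (x ^ k * exp x / fact k))"
    by (simp only: ch) (simp add: algebra_simps add_divide_distrib)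
  then show "(\<lambda>n. real n * (real (n choose k) * x ^ n / fact n)) sums ((real k + x) * (x ^ k * exp x / fact k))"
    by (subst sums_iff_shift'[of _ k, symmetric]) (simp add: binomial_eq_0)
qed

text \<open>Summing over n first gives one exponential series per k. With the weight n the term for
  k gains the factor k + (t - k) = t, independent of k; hence the second sum is just t times the
  first.\<close>

lemma irwin_hall_sums:
  assumes "t \<ge> 0"
  shows "(\<lambda>n. irwin_hall n t) sums renewal_fun t"
    and "(\<lambda>n. real n * irwin_hall n t) sums (t * renewal_fun t)"
proof -
  define m where "m = nat \<lfloor>t\<rfloor>"
  \<comment> \<open>The range of k is made independent of n so that the sums can be exchanged: terms
    with k > n vanish by the binomial coefficient, those with k > m by truncation.\<close>
  have eq: "irwin_hall n t = (\<Sum>k\<le>m. (- 1) ^ k * (real (n choose k) * (t - real k) ^ n / fact n))" for n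
  proof -
    let ?f = "\<lambda>k. (- 1) ^ k * real (n choose k) * trunc_power n (t - real k)"
    have out: "?f k = 0" if "k > n \<or> k > m" for k
    proof -
      have "t - real k < 0" if "k > m"
        using that assms by (simp add: m_def) linarith
      then show ?thesis
        using that by (auto simp: trunc_power_def binomial_eq_0)
    qed
    have "(\<Sum>k\<le>n. ?f k) = (\<Sum>k\<le>max n m. ?f k)"
      by (intro sum.mono_neutral_left) (use out in auto)
    also have "\<dots> = (\<Sum>k\<le>m. ?f k)"
      by (intro sum.mono_neutral_right) (use out in auto)
    also have "\<dots> = (\<Sum>k\<le>m. (- 1) ^ k * (real (n choose k) * (t - real k) ^ n))"
    proof (intro sum.cong refl)
      fix k assume "k \<in> {..m}"
      then have "t - real k \<ge> 0"
        using assms by (simp add: m_def) linarith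
      then show "?f k = (- 1) ^ k * (real (n choose k) * (t - real k) ^ n)"
        by (simp add: trunc_power_def)
    qed
    finally show ?thesis
      by (simp add: irwin_hall_def sum_divide_distrib)
  qed
  have "(\<lambda>n. \<Sum>k\<le>m. (- 1) ^ k * (real (n choose k) * (t - real k) ^ n / fact n)) sums
      (\<Sum>k\<le>m. (- 1) ^ k * ((t - real k) ^ k * exp (t - real k) / fact k))"
    by (intro sums_sum sums_mult exp_series_shifted)
  then show "(\<lambda>n. irwin_hall n t) sums renewal_fun t"
    by (simp add: eq renewal_fun_def m_def mult.assoc)
  have "(\<lambda>n. \<Sum>k\<le>m. (- 1) ^ k * (real n * (real (n choose k) * (t - real k) ^ n / fact n))) sums
      (\<Sum>k\<le>m. (- 1) ^ k * ((real k + (t - real k)) * ((t - real k) ^ k * exp (t - real k) / fact k)))"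
    by (intro sums_sum sums_mult exp_series_shifted)
  also have "(\<lambda>n. \<Sum>k\<le>m. (- 1) ^ k * (real n * (real (n choose k) * (t - real k) ^ n / fact n))) = (\<lambda>n. real n * irwin_hall n t)"
    by (simp add: eq sum_distrib_left mult_ac)
  also have "(\<Sum>k\<le>m. (- 1) ^ k * ((real k + (t - real k)) * ((t - real k) ^ k * exp (t - real k) / fact k))) = t * renewal_fun t"
    by (simp add: renewal_fun_def m_def sum_distrib_left mult_ac)
  finally show "(\<lambda>n. real n * irwin_hall n t) sums (t * renewal_fun t)" .
qed

text \<open>Induction on n: the new increment is independent of the partial sum, so the convolution
  integral reproduces the Irwin-Hall recursion. Nonnegativity is carried along because
  \<open>ennreal\<close> would hide negative values.\<close>

lemma (in prob_space) emeasure_renewal_sum_le: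
  assumes ind: "indep_vars (\<lambda>_. borel) X {1..}"
    and unif: "\<And>i. i \<ge> 1 \<Longrightarrow> distr M borel (X i) = uniform_measure lborel {0<..<1}"
  shows "emeasure M {\<omega> \<in> space M. renewal_sum X n \<omega> \<le> t} = ennreal (irwin_hall n t)
    \<and> 0 \<le> irwin_hall n t"
proof (induction n arbitrary: t)
  case 0
  \<comment> \<open>Since 0^0 = 1, \<open>trunc_power 0\<close> is the indicator of [0,
    \<infinity>), in agreement with the empty sum being 0.\<close>
  show ?case
    by (auto simp: renewal_sum_def irwin_hall_def trunc_power_def emeasure_space_1)
next
  case (Suc n)
  have rv [measurable]: "random_variable borel (X i)" if "i \<ge> 1" for i
    using ind that unfolding indep_vars_def2 by auto
  let ?S = "\<lambda>\<omega>. \<Sum>i\<in>{1..n}. X i \<omega>"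
  have rvS [measurable]: "random_variable borel ?S"
    by (intro borel_measurable_sum rv) auto
  have rvX [measurable]: "random_variable borel (X (Suc n))"
    by (rule rv) simp
  have "indep_vars (\<lambda>_. borel) X (insert (Suc n) {1..n})"
    by (rule indep_vars_subset[OF ind]) auto
  then have "indep_var borel (X (Suc n)) borel ?S"
    by (intro indep_vars_sum) auto
  then have conv: "distr M borel (\<lambda>\<omega>. X (Suc n) \<omega> + ?S \<omega>) = convolution (distr M borel (X (Suc n))) (distr M borel ?S)"
    by (rule sum_indep_random_variable) auto
  have [measurable]: "(\<lambda>x. irwin_hall n (t - x)) \<in> borel_measurable borel"
    unfolding irwin_hall_def trunc_power_def by measurable
  have nonneg: "0 \<le> irwin_hall n y" for y
    using Suc.IH by blast
  have "emeasure M {\<omega> \<in> space M. renewal_sum X (Suc n) \<omega> \<le> t}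
      = emeasure (distr M borel (\<lambda>\<omega>. X (Suc n) \<omega> + ?S \<omega>)) {..t}"
    by (subst emeasure_distr) (auto simp: renewal_sum_def add.commute intro!: arg_cong[where f = "emeasure M"])
  also have "\<dots> = (\<integral>\<^sup>+x. emeasure (distr M borel ?S) {a. a + x \<in> {..t}} \<partial>distr M borel (X (Suc n)))"
    unfolding conv
    by (rule convolution_emeasure) (auto intro!: finite_measure_distr)
  also have "\<dots> = (\<integral>\<^sup>+x. ennreal (irwin_hall n (t - x)) \<partial>uniform_measure lborel {0<..<1})"
  proof -
    have "emeasure (distr M borel ?S) {a. a + x \<in> {..t}} = ennreal (irwin_hall n (t - x))" for x
    proof -
      have "emeasure (distr M borel ?S) {a. a + x \<in> {..t}} = emeasure M {\<omega> \<in> space M. renewal_sum X n \<omega> \<le> t - x}"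
        by (subst emeasure_distr) (auto simp: renewal_sum_def algebra_simps intro!: arg_cong[where f = "emeasure M"])
      then show ?thesis
        using Suc.IH by simp
    qed
    then show ?thesis
      by (simp add: unif)
  qed
  also have "\<dots> = (\<integral>\<^sup>+x. ennreal (irwin_hall n (t - x)) * indicator {0<..<1} x \<partial>lborel) / emeasure lborel {0<..<1::real}"
    by (rule nn_integral_uniform_measure) auto
  also have "\<dots> = (\<integral>\<^sup>+x. ennreal (if x \<in> {0<..<1} then irwin_hall n (t - x) else 0) \<partial>lborel)"
    by (auto intro!: nn_integral_cong simp: indicator_def divide_ennreal_def)
  also have "\<dots> = ennreal (irwin_hall (Suc n) t)"
  proof (rule nn_integral_has_integral_lborel)
    show "((\<lambda>x. if x \<in> {0<..<1} then irwin_hall n (t - x) else 0) has_integral irwin_hall (Suc n) t) UNIV"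
      using irwin_hall_has_integral[of n t]
      by (subst has_integral_restrict_UNIV) (simp add: has_integral_Icc_iff_Ioo)
  qed (use nonneg in auto)
  finally show ?case
    using has_integral_nonneg[OF irwin_hall_has_integral[of n t]] nonneg by simp
qed

section \<open>Moments of the counting function as series\<close>

lemma (in prob_space) renewal_count_moments:
  assumes ind: "indep_vars (\<lambda>_. borel) X {1..}"
    and unif: "\<And>i. i \<ge> 1 \<Longrightarrow> distr M borel (X i) = uniform_measure lborel {0<..<1}"
    and t: "t \<ge> 0"
  shows "has_bochner_integral M (\<lambda>\<omega>. real (renewal_count X t \<omega>)) (renewal_fun t)"
    and "has_bochner_integral M (\<lambda>\<omega>. (real (renewal_count X t \<omega>))\<^sup>2) ((2 * t + 1) * renewal_fun t)"
proof -
  have rv [measurable]: "random_variable borel (X i)" if "i \<ge> 1" for i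
    using ind that unfolding indep_vars_def2 by auto
  have [measurable]: "random_variable borel (renewal_sum X n)" for n
    unfolding renewal_sum_def by (intro borel_measurable_sum rv) auto
  have [measurable]: "renewal_count X t \<in> measurable M (count_space UNIV)"
    unfolding renewal_count_def by measurable
  note cdf = emeasure_renewal_sum_le[OF ind unif]
  have pos: "AE \<omega> in M. \<forall>i\<ge>1. X i \<omega> > 0"
  proof (subst AE_all_countable, intro allI)
    fix i
    show "AE \<omega> in M. 1 \<le> i \<longrightarrow> X i \<omega> > 0"
    proof (cases "1 \<le> i")
      case True
      have "AE x in uniform_measure lborel {0<..<1::real}. x > 0"
        by (rule AE_uniform_measureI) auto
      then have "AE x in distr M borel (X i). x > 0"
        by (simp only: unif[OF True])
      then show ?thesis
        using True rv by (subst (asm) AE_distr_iff) auto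
    qed auto
  qed
  \<comment> \<open>The event that all partial sums stay below or at \<open>t\<close> has
    probability at most \<open>irwin_hall n t\<close> for every n, and these are terms of a
    convergent series.\<close>
  have fin: "AE \<omega> in M. \<exists>i. renewal_sum X i \<omega> > t"
  proof (rule AE_I)
    let ?A = "{\<omega> \<in> space M. \<forall>i. renewal_sum X i \<omega> \<le> t}"
    show "{\<omega> \<in> space M. \<not> (\<exists>i. renewal_sum X i \<omega> > t)} \<subseteq> ?A"
      by (auto simp: not_less)
    show "?A \<in> events"
      by measurable
    have "(\<lambda>n. irwin_hall n t) \<longlonglongrightarrow> 0"
      using irwin_hall_sums(1)[OF t] by (intro summable_LIMSEQ_zero) (simp add: sums_iff)
    then have "(\<lambda>n. ennreal (irwin_hall n t)) \<longlonglongrightarrow> ennreal 0"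
      by (rule tendsto_ennrealI)
    moreover have "emeasure M ?A \<le> ennreal (irwin_hall n t)" for n
      using cdf[of n t] by (auto intro!: emeasure_mono simp flip: cdf[THEN conjunct1])
    ultimately have "emeasure M ?A \<le> ennreal 0"
      by (intro tendsto_lowerbound) (auto intro!: always_eventually)
    then show "emeasure M ?A = 0"
      by simp
  qed
  \<comment> \<open>Positive increments make the partial sums monotone, so once the level is
    exceeded it stays exceeded.\<close>
  have count: "AE \<omega> in M. \<forall>n. n < renewal_count X t \<omega> \<longleftrightarrow> renewal_sum X n \<omega> \<le> t"
    using pos fin
  proof eventually_elim
    case (elim \<omega>)
    have mono: "renewal_sum X m \<omega> \<le> renewal_sum X n \<omega>" if "m \<le> n" for m n
      unfolding renewal_sum_def using elim(1) that by (intro sum_mono2) (auto intro: less_imp_le)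
    have "renewal_sum X (renewal_count X t \<omega>) \<omega> > t"
      unfolding renewal_count_def using elim(2) by (rule LeastI_ex)
    moreover have "renewal_sum X n \<omega> \<le> t" if "n < renewal_count X t \<omega>" for n
      using not_less_Least[OF that[unfolded renewal_count_def]] by simp
    ultimately show ?case
      using mono by (meson leD le_less_trans not_le)
  qed
  \<comment> \<open>The sum below N is the series of w(n) times the indicator of S_n \<le> t,
    integrated termwise. The weights 1 and 2n + 1 give N and, as a sum of odd numbers, N^2.\<close>
  have moment: "has_bochner_integral M (\<lambda>\<omega>. \<Sum>n<renewal_count X t \<omega>. w n) s"
    if w: "\<And>n. 0 \<le> w n" "(\<lambda>n. w n * irwin_hall n t) sums s" for w :: "nat \<Rightarrow> real" and s
  proof (rule has_bochner_integral_nn_integral)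
    show "(\<lambda>\<omega>. \<Sum>n<renewal_count X t \<omega>. w n) \<in> borel_measurable M"
      by measurable
    show "AE \<omega> in M. 0 \<le> (\<Sum>n<renewal_count X t \<omega>. w n)"
      using w(1) by (auto intro: sum_nonneg)
    show "0 \<le> s"
      using w cdf sums_le[of "\<lambda>_. 0" "\<lambda>n. w n * irwin_hall n t" 0 s] by auto
    have "(\<integral>\<^sup>+\<omega>. ennreal (\<Sum>n<renewal_count X t \<omega>. w n) \<partial>M)
        = (\<integral>\<^sup>+\<omega>. (\<Sum>n. ennreal (w n) * indicator {\<omega> \<in> space M. renewal_sum X n \<omega> \<le> t} \<omega>) \<partial>M)"
    proof (rule nn_integral_cong_AE)
      show "AE \<omega> in M. ennreal (\<Sum>n<renewal_count X t \<omega>. w n)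
          = (\<Sum>n. ennreal (w n) * indicator {\<omega> \<in> space M. renewal_sum X n \<omega> \<le> t} \<omega>)"
        using count AE_space
      proof eventually_elim
        case (elim \<omega>)
        have "(\<Sum>n. ennreal (w n) * indicator {\<omega> \<in> space M. renewal_sum X n \<omega> \<le> t} \<omega>)
            = (\<Sum>n<renewal_count X t \<omega>. ennreal (w n) * indicator {\<omega> \<in> space M. renewal_sum X n \<omega> \<le> t} \<omega>)"
          by (rule suminf_finite) (use elim in auto)
        also have "\<dots> = (\<Sum>n<renewal_count X t \<omega>. ennreal (w n))"
          by (intro sum.cong) (use elim in auto)
        finally show ?case
          using w(1) by (simp add: sum_ennreal)
      qed
    qed
    also have "\<dots> = (\<Sum>n. \<integral>\<^sup>+\<omega>. ennreal (w n) * indicator {\<omega> \<in> space M. renewal_sum X n \<omega> \<le> t} \<omega> \<partial>M)"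
      by (rule nn_integral_suminf) measurable
    also have "\<dots> = (\<Sum>n. ennreal (w n * irwin_hall n t))"
      using cdf w(1) by (simp add: nn_integral_cmult_indicator ennreal_mult)
    also have "\<dots> = ennreal s"
      using w cdf by (intro suminf_ennreal_eq) auto
    finally show "(\<integral>\<^sup>+\<omega>. ennreal (\<Sum>n<renewal_count X t \<omega>. w n) \<partial>M) = ennreal s" .
  qed
  show "has_bochner_integral M (\<lambda>\<omega>. real (renewal_count X t \<omega>)) (renewal_fun t)"
    using moment[of "\<lambda>_. 1" "renewal_fun t"] irwin_hall_sums(1)[OF t] by simp
  have "(\<Sum>n<N. 2 * real n + 1) = (real N)\<^sup>2" for N
    by (induction N) (auto simp: power2_eq_square algebra_simps)
  moreover have "(\<lambda>n. (2 * real n + 1) * irwin_hall n t) sums ((2 * t + 1) * renewal_fun t)"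
    using sums_add[OF sums_mult[OF irwin_hall_sums(2)[OF t], of 2] irwin_hall_sums(1)[OF t]]
    by (simp add: algebra_simps)
  ultimately show "has_bochner_integral M (\<lambda>\<omega>. (real (renewal_count X t \<omega>))\<^sup>2) ((2 * t + 1) * renewal_fun t)"
    using moment[of "\<lambda>n. 2 * real n + 1"] by simp
qed

section \<open>Expansions of the second moment and the variance\<close>

theorem corollary6p5:
  fixes M :: "'a measure" and X :: "nat \<Rightarrow> 'a \<Rightarrow> real"
  assumes "prob_space M"
    and "prob_space.indep_vars M (\<lambda>_. borel) X {1..}"
    and "\<And>i. i \<ge> 1 \<Longrightarrow> distr M borel (X i) = uniform_measure lborel {0<..<1}"
  shows "(\<exists>\<beta>1. char_root (Complex alpha1 \<beta>1) \<and>
            2.088843 \<le> - alpha1 \<and> - alpha1 < 2.088844 \<and>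
            7.461489 \<le> \<beta>1 \<and> \<beta>1 < 7.461490) \<and>
         (\<lambda>t. prob_space.expectation M (\<lambda>\<omega>. (real (renewal_count X t \<omega>))\<^sup>2)
               - (4 * t\<^sup>2 + 10 / 3 * t + 2 / 3))
           \<in> O[at_top](\<lambda>t. t * exp (alpha1 * t)) \<and>
         (\<lambda>t. prob_space.variance M (\<lambda>\<omega>. real (renewal_count X t \<omega>))
               - (2 / 3 * t + 2 / 9))
           \<in> O[at_top](\<lambda>t. t * exp (alpha1 * t))"
proof -
  interpret prob_space M
    by fact
  let ?N = "\<lambda>t \<omega>. real (renewal_count X t \<omega>)"
  obtain C where C: "\<And>t. t \<ge> 0 \<Longrightarrow> \<bar>renewal_fun t - (2 * t + 2 / 3)\<bar> \<le> C * exp (alpha1 * t)"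
    using renewal_fun_asymptotics by blast
  have "0 \<le> C"
    using C[of 0] by simp
  obtain \<beta> where \<beta>: "char_root (Complex alpha1 \<beta>)" "2.088843 \<le> - alpha1" "- alpha1 < 2.088844"
      "7.461489 \<le> \<beta>" "\<beta> < 7.461490"
    using alpha1_root by blast
  note moments = renewal_count_moments[OF assms(2,3)]
  have E1: "expectation (?N t) = renewal_fun t"
    and E2: "expectation (\<lambda>\<omega>. (?N t \<omega>)\<^sup>2) = (2 * t + 1) * renewal_fun t"
    if "t \<ge> 0" for t
    using moments[of t] that by (simp_all add: has_bochner_integral_iff)
  have V: "variance (?N t) = (2 * t + 1) * renewal_fun t - (renewal_fun t)\<^sup>2" if "t \<ge> 0" for t
    using moments[of t] that by (subst variance_eq) (simp_all add: has_bochner_integral_iff)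
  define e where "e t = renewal_fun t - (2 * t + 2 / 3)" for t
  have e: "\<bar>e t\<bar> \<le> C * exp (alpha1 * t)" "\<bar>e t\<bar> \<le> C" if "t \<ge> 1" for t
  proof -
    show "\<bar>e t\<bar> \<le> C * exp (alpha1 * t)"
      using C[of t] that by (simp add: e_def)
    also have "\<dots> \<le> C * 1"
      using \<beta>(2) that \<open>0 \<le> C\<close> by (intro mult_left_mono) (auto simp: mult_nonpos_nonneg)
    finally show "\<bar>e t\<bar> \<le> C"
      by simp
  qed
  have "(\<lambda>t. expectation (\<lambda>\<omega>. (?N t \<omega>)\<^sup>2) - (4 * t\<^sup>2 + 10 / 3 * t + 2 / 3))
      \<in> O[at_top](\<lambda>t. t * exp (alpha1 * t))"
  proof (rule bigoI)
    show "eventually (\<lambda>t. norm (expectation (\<lambda>\<omega>. (?N t \<omega>)\<^sup>2) - (4 * t\<^sup>2 + 10 / 3 * t + 2 / 3))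
        \<le> (3 * C) * norm (t * exp (alpha1 * t))) at_top"
      using eventually_ge_at_top[of 1]
    proof eventually_elim
      case (elim t)
      \<comment> \<open>The polynomial factors as (2t + 1)(2t + 2/3), so only the error of the
        renewal function remains.\<close>
      have "expectation (\<lambda>\<omega>. (?N t \<omega>)\<^sup>2) - (4 * t\<^sup>2 + 10 / 3 * t + 2 / 3) = (2 * t + 1) * e t"
        using elim by (subst E2) (auto simp: e_def power2_eq_square algebra_simps)
      also have "norm \<dots> = (2 * t + 1) * \<bar>e t\<bar>"
        using elim by (simp add: abs_mult)
      also have "\<dots> \<le> (3 * t) * (C * exp (alpha1 * t))"
        using elim e by (intro mult_mono) auto
      finally show ?case
        using elim by (simp add: abs_mult mult_ac)
    qed
  qed
  moreover have "(\<lambda>t. variance (?N t) - (2 / 3 * t + 2 / 9)) \<in> O[at_top](\<lambda>t. t * exp (alpha1 * t))"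
  proof (rule bigoI)
    show "eventually (\<lambda>t. norm (variance (?N t) - (2 / 3 * t + 2 / 9))
        \<le> ((3 + C) * C) * norm (t * exp (alpha1 * t))) at_top"
      using eventually_ge_at_top[of 1]
    proof eventually_elim
      case (elim t)
      \<comment> \<open>The variance is U (2t + 1 - U) with U = 2t + 2/3 + e. The quadratic terms in
        t cancel, and the crude bound |e| \<le> C keeps the factor in front of the last
        \<open>e t\<close> linear in t.\<close>
      have "variance (?N t) - (2 / 3 * t + 2 / 9) = - (2 * t + 1 / 3 + e t) * e t"
        using elim by (subst V) (auto simp: e_def power2_eq_square algebra_simps)
      also have "norm \<dots> = \<bar>2 * t + 1 / 3 + e t\<bar> * \<bar>e t\<bar>"
        by (simp only: real_norm_def abs_mult abs_minus_cancel)
      also have "\<dots> \<le> ((3 + C) * t) * (C * exp (alpha1 * t))"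
      proof (intro mult_mono e elim)
        have "\<bar>2 * t + 1 / 3 + e t\<bar> \<le> 3 * t + C"
          using elim e(2)[of t] by (simp add: abs_le_iff)
        also have "\<dots> \<le> (3 + C) * t"
          using elim \<open>0 \<le> C\<close> mult_left_mono[of 1 t C] by (simp add: distrib_right)
        finally show "\<bar>2 * t + 1 / 3 + e t\<bar> \<le> (3 + C) * t" .
      qed (use elim \<open>0 \<le> C\<close> in auto)
      finally show ?case
        using elim by (simp add: abs_mult mult_ac)
    qed
  qed
  ultimately show ?thesis
    using \<beta> by blast
qed

end
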